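(* Let $G$ be an undirected, unweighted, connected graph with $n$ nodes that contains at least one cycle, and let $k\ge 2$ be an integer. There exists a randomized algorithm that, with probability at least $1-\frac{1}{n}$, gives a $2^k$-approximation to the girth $g$ of $G$ (i.e. returns a cycle of $G$ of length $\tilde g$ with $g\le \tilde g\le 2^k g$), and that runs in expected time $O\!\left(n^{1+1/k}\, k \log n\right)$.
   Context: The girth of a graph is the length of its shortest cycle. Graphs are given in adjacency list representation. $\log x$ denotes the natural logarithm. *)

theory Defs
  imports "HOL-Probability.Probability" "Graph_Theory.Graph_Theory"
begin

section \<open>Cycles and girth\<close>

text \<open>
  Finite simple undirected graphs are the symmetric loop-free digraphs of \<^locale>\<open>pair_graph\<close>.
  The two arcs of a single edge form a directed cycle of length 2, so an undirected
  cycle is a directed cycle (without repeated vertices) of length at least 3.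
\<close>

definition ucycle :: "'a pair_pre_digraph \<Rightarrow> ('a \<times> 'a) list \<Rightarrow> bool" where
  "ucycle G p \<longleftrightarrow> pre_digraph.cycle (with_proj G) p \<and> 3 \<le> length p"

text \<open>On acyclic graphs the infimum is taken over the empty set and the value is meaningless.\<close>

definition girth :: "'a pair_pre_digraph \<Rightarrow> nat" where
  "girth G = (INF p \<in> {p. ucycle G p}. length p)"

section \<open>A randomized word RAM\<close>

text \<open>
  Programs are written in a structured imperative language over finitely many registers and
  finitely many arrays. All of them contain \<open>w\<close>-bit words, and arrays are indexed by words.
  Arithmetic is modulo \<open>2 ^ w\<close>, except that subtraction is truncated at 0.
\<close>

datatype aexp =
    Const nat
  | Reg string
  | Load string aexp
  | Add aexp aexp
  | Sub aexp aexp
  | Mul aexp aexp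
  | Div aexp aexp

datatype bexp =
    Eq aexp aexp
  | Less aexp aexp
  | BNot bexp
  | BAnd bexp bexp

datatype com =
    Skip
  | Assign string aexp
  | Store string aexp aexp
  | Random string aexp
  | Seq com com
  | Cond bexp com com
  | While bexp com

record state =
  regs :: "string \<Rightarrow> nat"
  arrs :: "string \<Rightarrow> nat \<Rightarrow> nat"
  time :: nat

primrec aval :: "nat \<Rightarrow> aexp \<Rightarrow> state \<Rightarrow> nat" where
  "aval w (Const i) s = take_bit w i"
| "aval w (Reg x) s = regs s x"
| "aval w (Load a e) s = arrs s a (aval w e s)"
| "aval w (Add e f) s = take_bit w (aval w e s + aval w f s)"
| "aval w (Sub e f) s = aval w e s - aval w f s"
| "aval w (Mul e f) s = take_bit w (aval w e s * aval w f s)"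
| "aval w (Div e f) s = aval w e s div aval w f s"

primrec bval :: "nat \<Rightarrow> bexp \<Rightarrow> state \<Rightarrow> bool" where
  "bval w (Eq e f) s \<longleftrightarrow> aval w e s = aval w f s"
| "bval w (Less e f) s \<longleftrightarrow> aval w e s < aval w f s"
| "bval w (BNot b) s \<longleftrightarrow> \<not> bval w b s"
| "bval w (BAnd b c) s \<longleftrightarrow> bval w b s \<and> bval w c s"

definition tick :: "state \<Rightarrow> state" where
  "tick s = s\<lparr>time := Suc (time s)\<rparr>"

definition set_reg :: "string \<Rightarrow> nat \<Rightarrow> state \<Rightarrow> state" where
  "set_reg x v s = s\<lparr>regs := (regs s)(x := v)\<rparr>"

definition set_arr :: "string \<Rightarrow> nat \<Rightarrow> nat \<Rightarrow> state \<Rightarrow> state" where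
  "set_arr a i v s = s\<lparr>arrs := (arrs s)(a := (arrs s a)(i := v))\<rparr>"

text \<open>Least fixed point in the order on subprobability distributions: the mass of the
  non-terminating runs is missing from the result.\<close>

partial_function (spmf) while_spmf ::
    "('s \<Rightarrow> bool) \<Rightarrow> ('s \<Rightarrow> 's spmf) \<Rightarrow> 's \<Rightarrow> 's spmf" where
  "while_spmf b f s =
     (if b s then bind_spmf (f s) (\<lambda>s'. while_spmf b f s') else return_spmf s)"

text \<open>
  Every command and every test costs one unit. The expressions in a program have constant size,
  so charging for each of their operations would only change running times by a constant factor.
  \<open>Random x e\<close> draws a uniformly distributed number below the value of \<open>e\<close> (and aborts, which
  counts as non-termination, if that value is 0). All draws are independent.
  The field \<open>time\<close> is not accessible to the program.
\<close>

primrec exec :: "nat \<Rightarrow> com \<Rightarrow> state \<Rightarrow> state spmf" where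
  "exec w Skip s = return_spmf (tick s)"
| "exec w (Assign x e) s = return_spmf (tick (set_reg x (aval w e s) s))"
| "exec w (Store a e f) s = return_spmf (tick (set_arr a (aval w e s) (aval w f s) s))"
| "exec w (Random x e) s =
     map_spmf (\<lambda>v. tick (set_reg x v s)) (spmf_of_set {..<aval w e s})"
| "exec w (Seq c d) s = bind_spmf (exec w c s) (exec w d)"
| "exec w (Cond b c d) s = (if bval w b s then exec w c (tick s) else exec w d (tick s))"
| "exec w (While b c) s =
     map_spmf tick (while_spmf (bval w b) (\<lambda>s'. exec w c (tick s')) s)"

definition expected_time :: "state spmf \<Rightarrow> ennreal" where
  "expected_time R =
     (\<integral>\<^sup>+ r. (case r of None \<Rightarrow> \<infinity> | Some s \<Rightarrow> of_nat (time s)) \<partial>measure_pmf R)"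

section \<open>Input and output\<close>

definition adjacency_lists :: "nat pair_pre_digraph \<Rightarrow> nat list list \<Rightarrow> bool" where
  "adjacency_lists G A \<longleftrightarrow>
     pverts G = {..<length A} \<and>
     (\<forall>v<length A. distinct (A ! v) \<and> set (A ! v) = {u. (v, u) \<in> parcs G})"

definition array_of :: "nat list \<Rightarrow> nat \<Rightarrow> nat" where
  "array_of xs i = (if i < length xs then xs ! i else 0)"

text \<open>
  The adjacency lists are stored one after the other in the array \<open>adj\<close>; the list of vertex \<open>v\<close>
  occupies the positions from \<open>off v\<close> (inclusive) to \<open>off (v + 1)\<close> (exclusive).
  All other registers and array cells are initially 0.
\<close>

definition input_state :: "nat list list \<Rightarrow> nat \<Rightarrow> state" where
  "input_state A k =
     \<lparr>regs = (\<lambda>_. 0)(''n'' := length A, ''k'' := k),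
      arrs = (\<lambda>_ _. 0)
        (''off'' := array_of (map (\<lambda>v. length (concat (take v A))) [0..<Suc (length A)]),
         ''adj'' := array_of (concat A)),
      time = 0\<rparr>"

text \<open>
  The output is the sequence of vertices stored in the first \<open>len\<close> cells of the array \<open>out\<close>.
  It denotes the closed walk that returns to the first vertex at the end, which has \<open>len\<close> arcs.
\<close>

definition output_walk :: "state \<Rightarrow> (nat \<times> nat) list" where
  "output_walk s = (let c = map (arrs s ''out'') [0..<regs s ''len''] in vwalk_arcs (c @ [hd c]))"

end

theory Submission
  imports Defs
begin

text \<open>
  Fix \<open>r\<close> with \<open>r ^ k > n\<close>, \<open>r = O(n powr (1 / k))\<close>, and \<open>L\<close> with \<open>2 ^ L \<ge> n\<close>. At level \<open>i\<close> (while
  \<open>r ^ i \<le> n\<close>) the algorithm draws about \<open>L * n / r ^ i\<close> random vertices and runs from each a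
  breadth-first search that stops at the first non-tree edge or after visiting \<open>r ^ (i + 1)\<close>
  vertices. Only tree edges are scanned before the first non-tree edge, so a level costs
  \<open>O(n * r * L)\<close>, whatever the number of edges. The shortest cycle seen is kept.

  Let \<open>Z\<close> be the vertex set of a shortest cycle, of length \<open>g\<close>. Let \<open>P i\<close> say that there are
  \<open>r ^ i\<close> vertices within distance \<open>2 ^ i * g - 1\<close> of every vertex of \<open>Z\<close>. Then \<open>P 0\<close> holds and
  \<open>P k\<close> fails. Choose \<open>i\<close> with \<open>P i\<close> but not \<open>P (i + 1)\<close>. With probability at least \<open>1 - 1 / n\<close>
  some sample of level \<open>i\<close> hits a set \<open>S\<close> witnessing \<open>P i\<close>. With \<open>d = 2 ^ i * g - 1\<close>, the search
  from that sample meets a non-tree edge before it expands a vertex at depth more than \<open>d\<close>, because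
  otherwise \<open>Z\<close> would lie in a tree. It cannot stop for having visited \<open>r ^ (i + 1)\<close> vertices, since
  all of these would be within \<open>d + 1\<close> of the root and witness \<open>P (i + 1)\<close>. So it finds a cycle of length
  at most \<open>2 * (d + 1) = 2 ^ (i + 1) * g\<close>, and \<open>i < k\<close>. The choice of \<open>i\<close> depends on the graph alone,
  so only one level has to succeed and no union bound is needed.
\<close>

section \<open>Weakest preconditions\<close>

text \<open>Total correctness in which every random draw is an adversarial choice. A time bound
  obtained this way holds on each run, so it bounds the expectation as well.\<close>

definition wp :: "nat \<Rightarrow> com \<Rightarrow> state \<Rightarrow> (state \<Rightarrow> bool) \<Rightarrow> bool" where
  "wp w c s Q \<longleftrightarrow> lossless_spmf (exec w c s) \<and> (\<forall>s'\<in>set_spmf (exec w c s). Q s')"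

lemma wp_Skip [simp]: "wp w Skip s Q \<longleftrightarrow> Q (tick s)"
  and wp_Assign [simp]: "wp w (Assign x e) s Q \<longleftrightarrow> Q (tick (set_reg x (aval w e s) s))"
  and wp_Store [simp]: "wp w (Store a e f) s Q \<longleftrightarrow> Q (tick (set_arr a (aval w e s) (aval w f s) s))"
  and wp_Random [simp]: "wp w (Random x e) s Q \<longleftrightarrow>
    aval w e s \<noteq> 0 \<and> (\<forall>v<aval w e s. Q (tick (set_reg x v s)))"
  and wp_Seq [simp]: "wp w (Seq c d) s Q \<longleftrightarrow> wp w c s (\<lambda>s'. wp w d s' Q)"
  and wp_Cond [simp]: "wp w (Cond b c d) s Q \<longleftrightarrow>
    (if bval w b s then wp w c (tick s) Q else wp w d (tick s) Q)"
  by (auto simp: wp_def lessThan_empty_iff set_bind_spmf)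

lemma wp_mono: "wp w c s Q \<Longrightarrow> (\<And>s'. Q s' \<Longrightarrow> R s') \<Longrightarrow> wp w c s R"
  by (auto simp: wp_def)

text \<open>The final \<open>tick\<close> of \<open>While\<close> sits outside the fixed point.
  Pushing \<open>map_spmf\<close> through the bind leaves one \<open>tick\<close> per test, the
  failing test included.\<close>

lemma exec_While_unfold:
  "exec w (While b c) s =
    (if bval w b s then exec w (Seq c (While b c)) (tick s) else return_spmf (tick s))"
  by (subst exec.simps(7), subst while_spmf.simps)
     (simp add: map_spmf_bind_spmf o_def exec.simps(7)[abs_def])

lemma wp_While_unfold:
  "wp w (While b c) s Q \<longleftrightarrow>
    (if bval w b s then wp w c (tick s) (\<lambda>s'. wp w (While b c) s' Q) else Q (tick s))"
proof -
  have "wp w (While b c) s Q \<longleftrightarrow>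
    (if bval w b s then wp w (Seq c (While b c)) (tick s) Q else Q (tick s))"
    unfolding wp_def exec_While_unfold[of w b c s] by simp
  then show ?thesis by simp
qed

text \<open>Induction on \<open>m s\<close>: as \<open>m\<close> drops on every outcome of the body,
  the number of iterations is bounded on all runs and no mass is lost.\<close>

lemma wp_While:
  fixes m :: "state \<Rightarrow> nat"
  assumes "I s"
    and "\<And>s. I s \<Longrightarrow> bval w b s \<Longrightarrow> wp w c (tick s) (\<lambda>s'. I s' \<and> m s' < m s)"
    and "\<And>s. I s \<Longrightarrow> \<not> bval w b s \<Longrightarrow> Q (tick s)"
  shows "wp w (While b c) s Q"
  using assms(1)
proof (induction "m s" arbitrary: s rule: less_induct)
  case less
  show ?case
  proof (cases "bval w b s")
    case True
    then show ?thesis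
      using assms(2)[OF less.prems True] less.hyps
      by (subst wp_While_unfold) (auto elim!: wp_mono)
  next
    case False
    then show ?thesis using assms(3) less.prems by (subst wp_While_unfold) auto
  qed
qed

section \<open>Frame conditions read off from the syntax\<close>

primrec written_regs :: "com \<Rightarrow> string set" where
  "written_regs Skip = {}"
| "written_regs (Assign x e) = {x}"
| "written_regs (Store a e f) = {}"
| "written_regs (Random x e) = {x}"
| "written_regs (Seq c d) = written_regs c \<union> written_regs d"
| "written_regs (Cond b c d) = written_regs c \<union> written_regs d"
| "written_regs (While b c) = written_regs c"

primrec written_arrs :: "com \<Rightarrow> string set" where
  "written_arrs Skip = {}"
| "written_arrs (Assign x e) = {}"
| "written_arrs (Store a e f) = {a}"
| "written_arrs (Random x e) = {}"
| "written_arrs (Seq c d) = written_arrs c \<union> written_arrs d"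
| "written_arrs (Cond b c d) = written_arrs c \<union> written_arrs d"
| "written_arrs (While b c) = written_arrs c"

definition unchanged :: "string set \<Rightarrow> string set \<Rightarrow> state \<Rightarrow> state \<Rightarrow> bool" where
  "unchanged X Y s s' \<longleftrightarrow> (\<forall>x. x \<notin> X \<longrightarrow> regs s' x = regs s x) \<and> (\<forall>a. a \<notin> Y \<longrightarrow> arrs s' a = arrs s a)"

lemma unchanged_trans: "unchanged X Y s s' \<Longrightarrow> unchanged X Y s' s'' \<Longrightarrow> unchanged X Y s s''"
  and unchanged_mono: "unchanged X Y s s' \<Longrightarrow> X \<subseteq> X' \<Longrightarrow> Y \<subseteq> Y' \<Longrightarrow> unchanged X' Y' s s'"
  and unchanged_refl: "unchanged X Y s s"
  by (auto simp: unchanged_def)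

lemma state_simps [simp]:
  "regs (tick s) = regs s" "arrs (tick s) = arrs s" "time (tick s) = Suc (time s)"
  "regs (set_reg x v s) = (regs s)(x := v)" "arrs (set_reg x v s) = arrs s"
  "time (set_reg x v s) = time s"
  "regs (set_arr a i v s) = regs s"
  "arrs (set_arr a i v s) = (arrs s)(a := (arrs s a)(i := v))"
  "time (set_arr a i v s) = time s"
  by (auto simp: tick_def set_reg_def set_arr_def)

text \<open>Fixed-point induction: the bound on the support is admissible and holds for the empty
  subdistribution, so loops that may diverge are covered.\<close>

lemma while_spmf_invariant:
  assumes "\<And>s s'. s' \<in> set_spmf (f s) \<Longrightarrow> R s s'"
    and "\<And>s. R s s" and "\<And>s s' s''. R s s' \<Longrightarrow> R s' s'' \<Longrightarrow> R s s''"
  shows "s' \<in> set_spmf (while_spmf b f s) \<Longrightarrow> R s s'"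
proof -
  have "\<forall>s. set_spmf (while_spmf b f s) \<subseteq> {s'. R s s'}"
  proof (induction rule: while_spmf.fixp_induct)
    case 1
    show ?case by simp
  next
    case 2 show ?case by simp
  next
    case (3 g)
    then show ?case using assms by (auto simp: set_bind_spmf subset_iff) metis
  qed
  then show "s' \<in> set_spmf (while_spmf b f s) \<Longrightarrow> R s s'" by blast
qed

lemma exec_unchanged:
  "s' \<in> set_spmf (exec w c s) \<Longrightarrow> unchanged (written_regs c) (written_arrs c) s s'"
proof (induction c arbitrary: s s')
  case (Seq c d)
  then show ?case
    by (auto simp: set_bind_spmf) (meson Un_upper1 Un_upper2 unchanged_mono unchanged_trans)
next
  case (Cond b c d)
  have *: "unchanged X Y (tick s) s' \<Longrightarrow> unchanged X Y s s'" for X Y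
    by (simp add: unchanged_def)
  from Cond show ?case
    by (auto split: if_splits) (meson * Un_upper1 Un_upper2 unchanged_mono)+
next
  case (While b c)
  have tick1: "unchanged X Y (tick s) s' \<Longrightarrow> unchanged X Y s s'"
    and tick2: "unchanged X Y s s' \<Longrightarrow> unchanged X Y s (tick s')" for X Y s s'
    by (simp_all add: unchanged_def)
  from While.prems obtain s1 where s1: "s' = tick s1"
    and "s1 \<in> set_spmf (while_spmf (bval w b) (\<lambda>s'. exec w c (tick s')) s)"
    by auto
  from this(2) have "unchanged (written_regs c) (written_arrs c) s s1"
    by (rule while_spmf_invariant[rotated 3])
      (auto intro: unchanged_trans unchanged_refl dest!: While.IH tick1)
  then show ?case using s1 tick2 by simp
qed (auto simp: unchanged_def)

lemma wp_unchanged: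
  assumes "wp w c s Q"
    and "\<And>s'. Q s' \<Longrightarrow> unchanged (written_regs c) (written_arrs c) s s' \<Longrightarrow> R s'"
  shows "wp w c s R"
  using assms exec_unchanged by (auto simp: wp_def)

text \<open>The frame condition relative to the state before the loop joins the invariant, so that
  \<open>I\<close> has to mention only what the body writes.\<close>

lemma wp_While_unchanged:
  fixes m :: "state \<Rightarrow> nat"
  assumes I: "I s"
    and step: "\<And>s'. I s' \<Longrightarrow> unchanged (written_regs c) (written_arrs c) s s' \<Longrightarrow> bval w b s' \<Longrightarrow>
      wp w c (tick s') (\<lambda>s''. I s'' \<and> m s'' < m s')"
    and exit: "\<And>s'. I s' \<Longrightarrow> unchanged (written_regs c) (written_arrs c) s s' \<Longrightarrow> \<not> bval w b s' \<Longrightarrow>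
      Q (tick s')"
  shows "wp w (While b c) s Q"
proof (rule wp_While[where m = m
      and I = "\<lambda>s'. I s' \<and> unchanged (written_regs c) (written_arrs c) s s'"])
  fix s' assume *: "I s' \<and> unchanged (written_regs c) (written_arrs c) s s'" "bval w b s'"
  show "wp w c (tick s') (\<lambda>s''. (I s'' \<and> unchanged (written_regs c) (written_arrs c) s s'') \<and> m s'' < m s')"
  proof (rule wp_unchanged)
    show "wp w c (tick s') (\<lambda>s''. I s'' \<and> m s'' < m s')" using * step by blast
  next
    fix s'' assume "I s'' \<and> m s'' < m s'"
      "unchanged (written_regs c) (written_arrs c) (tick s') s''"
    then show "(I s'' \<and> unchanged (written_regs c) (written_arrs c) s s'') \<and> m s'' < m s'"
      using * by (auto simp: unchanged_def)
  qed
qed (use I exit in \<open>auto simp: unchanged_refl\<close>)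

lemma expected_time_le:
  assumes "wp w c s (\<lambda>s'. real (time s') \<le> B)"
  shows "expected_time (exec w c s) \<le> ennreal B"
proof -
  have "expected_time (exec w c s) \<le> (\<integral>\<^sup>+ r. ennreal B \<partial>measure_pmf (exec w c s))"
    unfolding expected_time_def
  proof (rule nn_integral_mono_AE, rule AE_pmfI)
    fix r assume r: "r \<in> set_pmf (exec w c s)"
    moreover have "None \<notin> set_pmf (exec w c s)"
      using assms by (simp add: wp_def lossless_iff_set_pmf_None)
    ultimately obtain s' where s': "r = Some s'" by (cases r) auto
    then have "real (time s') \<le> B"
      using assms r by (simp add: wp_def in_set_spmf)
    then show "(case r of None \<Rightarrow> \<infinity> | Some s \<Rightarrow> of_nat (time s)) \<le> ennreal B"
      using s' by (simp add: ennreal_of_nat_eq_real_of_nat ennreal_leI)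
  qed
  then show ?thesis by simp
qed

section \<open>Probabilities of events on the final state\<close>

definition pr :: "nat \<Rightarrow> com \<Rightarrow> state \<Rightarrow> (state \<Rightarrow> bool) \<Rightarrow> real" where
  "pr w c s Q = measure (measure_spmf (exec w c s)) {s'. Q s'}"

lemma pr_le_1: "pr w c s Q \<le> 1"
  unfolding pr_def by (rule measure_spmf.subprob_measure_le_1)

lemma pr_nonneg: "0 \<le> pr w c s Q"
  by (simp add: pr_def)

lemma pr_eq_1:
  assumes "wp w c s Q"
  shows "pr w c s Q = 1"
proof -
  have "1 = measure (measure_spmf (exec w c s)) (space (measure_spmf (exec w c s)))"
    using assms by (simp add: wp_def lossless_spmf_def weight_spmf_def)
  also have "\<dots> = pr w c s Q"
    unfolding pr_def using assms
    by (intro measure_spmf.finite_measure_eq_AE) (auto simp: wp_def)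
  finally show ?thesis by simp
qed

lemma measure_bind_spmf:
  "measure (measure_spmf (bind_spmf p f)) A = (\<integral>x. measure (measure_spmf (f x)) A \<partial>measure_spmf p)"
proof -
  have "ennreal (measure (measure_spmf (bind_spmf p f)) A) =
      (\<integral>\<^sup>+x. ennreal (measure (measure_spmf (f x)) A) \<partial>measure_spmf p)"
    unfolding measure_spmf.emeasure_eq_measure[symmetric]
    by (simp add: measure_spmf_bind emeasure_bind[where N="count_space UNIV"]
        space_measure_spmf space_subprob_algebra)
  also have "\<dots> = ennreal (\<integral>x. measure (measure_spmf (f x)) A \<partial>measure_spmf p)"
    by (intro nn_integral_eq_integral measure_spmf.integrable_const_bound[where B = 1])
      (auto simp: measure_spmf.subprob_measure_le_1)
  finally show ?thesis
    by simp
qed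

lemma pr_Seq: "pr w (Seq c d) s Q = (\<integral>s'. pr w d s' Q \<partial>measure_spmf (exec w c s))"
  by (simp add: pr_def measure_bind_spmf)

lemma integrable_pr: "integrable (measure_spmf p) (\<lambda>s'. pr w d s' Q)"
  by (intro measure_spmf.integrable_const_bound[where B = 1]) (auto simp: pr_nonneg pr_le_1)

text \<open>For a first phase with guaranteed outcome: the bound \<open>q\<close> holds from each
  state reached, hence on average, because losslessness keeps the total weight at 1.\<close>

lemma pr_Seq_ge:
  assumes "wp w c s R" and "\<And>s'. R s' \<Longrightarrow> q \<le> pr w d s' Q"
  shows "q \<le> pr w (Seq c d) s Q"
proof -
  have "q = (\<integral>s'. q \<partial>measure_spmf (exec w c s))"
    using assms(1) by (simp add: wp_def lossless_spmf_def weight_spmf_def)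
  also have "\<dots> \<le> (\<integral>s'. pr w d s' Q \<partial>measure_spmf (exec w c s))"
    using assms by (intro integral_mono_AE integrable_pr) (auto simp: wp_def)
  finally show ?thesis by (simp add: pr_Seq)
qed

text \<open>The opposite situation: luck in the first phase, a guaranteed second phase. On
  \<open>R\<close> the integrand is 1, elsewhere it is at least 0.\<close>

lemma pr_Seq_wp:
  assumes "q \<le> pr w c s R" and "\<And>s'. R s' \<Longrightarrow> wp w d s' Q"
  shows "q \<le> pr w (Seq c d) s Q"
proof -
  have "integrable (measure_spmf (exec w c s)) (\<lambda>s'. of_bool (R s') :: real)"
    by (intro measure_spmf.integrable_const_bound[where B = 1]) auto
  have "pr w c s R = (\<integral>s'. of_bool (R s') \<partial>measure_spmf (exec w c s))"
    by (simp add: pr_def indicator_def[symmetric, of _ "{s'. R s'}", simplified])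
  also have "\<dots> \<le> (\<integral>s'. pr w d s' Q \<partial>measure_spmf (exec w c s))"
    using assms \<open>integrable _ _\<close>
    by (intro integral_mono integrable_pr) (auto simp: indicator_def pr_eq_1 pr_nonneg)
  finally show ?thesis using assms(1) by (simp add: pr_Seq)
qed

lemma pr_Random_Seq:
  "pr w (Seq (Random x e) d) s Q =
    (\<Sum>v<aval w e s. pr w d (tick (set_reg x v s)) Q) / real (aval w e s)"
  by (simp add: pr_def bind_map_spmf o_def measure_bind_spmf integral_spmf_of_set)

lemma pr_While_unfold:
  "pr w (While b c) s Q =
    (if bval w b s then pr w (Seq c (While b c)) (tick s) Q else of_bool (Q (tick s)))"
  unfolding pr_def exec_While_unfold[of w b c s]
  by (simp add: measure_spmf_return_spmf measure_return indicator_def del: exec.simps)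

section \<open>Trees and cycles\<close>

text \<open>Nodes are queue positions with root 0, not vertices. The guard \<open>par i < i\<close>
  gives termination for arbitrary array contents.\<close>

function depth :: "(nat \<Rightarrow> nat) \<Rightarrow> nat \<Rightarrow> nat" where
  "depth par i = (if 0 < i \<and> par i < i then Suc (depth par (par i)) else 0)"
  by auto
termination by (relation "Wellfounded.measure snd") auto

declare depth.simps [simp del]

text \<open>The tree path from \<open>i\<close> to \<open>j\<close> through their lowest common
  ancestor. Ancestors have smaller positions, so the larger endpoint is never the common ancestor
  and can be stripped off. The default \<open>[]\<close> occurs only where \<open>par\<close> fails
  to decrease.\<close>

function climb :: "(nat \<Rightarrow> nat) \<Rightarrow> nat \<Rightarrow> nat \<Rightarrow> nat list" where
  "climb par i j =
    (if i = j then [i]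
     else if j < i then (if par i < i then i # climb par (par i) j else [])
     else (if par j < j then climb par i (par j) @ [j] else []))"
  by auto
termination by (relation "Wellfounded.measure (\<lambda>(par, i, j). i + j)") auto

declare climb.simps [simp del]

definition tree_adjacent :: "(nat \<Rightarrow> nat) \<Rightarrow> nat \<Rightarrow> nat \<Rightarrow> bool" where
  "tree_adjacent par i j \<longleftrightarrow> (0 < j \<and> par j = i) \<or> (0 < i \<and> par i = j)"

lemma climb_ne: "\<forall>i<t. 0 < i \<longrightarrow> par i < i \<Longrightarrow> i < t \<Longrightarrow> j < t \<Longrightarrow> climb par i j \<noteq> []"
  by (induction par i j rule: climb.induct) (subst climb.simps, auto)

text \<open>Each recursive call removes an endpoint exceeding every remaining position, which gives
  distinctness, and lowers one of the two depths by one, which gives the length.\<close>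

lemma climb_props:
  assumes "\<forall>i<t. 0 < i \<longrightarrow> par i < i" "i < t" "j < t"
  shows "hd (climb par i j) = i \<and> last (climb par i j) = j \<and> distinct (climb par i j) \<and>
    set (climb par i j) \<subseteq> {..max i j} \<and>
    (\<forall>(a, b) \<in> set (vwalk_arcs (climb par i j)). tree_adjacent par a b) \<and>
    length (climb par i j) \<le> depth par i + depth par j + 1"
  using assms
proof (induction par i j rule: climb.induct)
  case (1 par i j)
  consider "i = j" | "j < i" | "i < j" by linarith
  then show ?case
  proof cases
    case 1
    then show ?thesis by (simp add: climb.simps)
  next
    case 2
    with "1.prems" have lt: "par i < i" "par i < t" by auto
    note IH = "1.IH"(1)[OF _ 2 lt(1) "1.prems"(1) lt(2) "1.prems"(3)]
    have ne: "climb par (par i) j \<noteq> []"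
      using climb_ne "1.prems" lt by blast
    have c: "climb par i j = i # climb par (par i) j"
      using 2 lt by (subst climb.simps) auto
    have d: "depth par i = Suc (depth par (par i))"
      using 2 lt by (subst depth.simps) auto
    show ?thesis
      using IH 2 lt ne unfolding c d by (auto simp: tree_adjacent_def)
  next
    case 3
    with "1.prems" have lt: "par j < j" "par j < t" by auto
    note IH = "1.IH"(2)[OF _ _ lt(1) "1.prems"(1) "1.prems"(2) lt(2)]
    have ne: "climb par i (par j) \<noteq> []"
      using climb_ne "1.prems" lt by blast
    have c: "climb par i j = climb par i (par j) @ [j]"
      using 3 lt by (subst climb.simps) auto
    have d: "depth par j = Suc (depth par (par j))"
      using 3 lt by (subst depth.simps) auto
    show ?thesis
      using IH 3 lt ne unfolding c d by (auto simp: tree_adjacent_def vwalk_arcs_append)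
  qed
qed

text \<open>A path with one node would give \<open>i = j\<close>; one with two nodes would make them
  adjacent in the tree.\<close>

lemma length_climb_ge_3:
  assumes "\<forall>i<t. 0 < i \<longrightarrow> par i < i" "i < t" "j < t" "i \<noteq> j" "\<not> tree_adjacent par i j"
  shows "3 \<le> length (climb par i j)"
proof (rule ccontr)
  note P = climb_props[OF assms(1-3)] and ne = climb_ne[OF assms(1-3)]
  assume "\<not> ?thesis"
  then have "length (climb par i j) = 1 \<or> length (climb par i j) = 2"
    using ne by (cases "length (climb par i j)") (auto simp: not_le)
  then show False
    using P assms by (auto simp: length_Suc_conv numeral_2_eq_2)
qed

lemma length_vwalk_arcs: "length (vwalk_arcs c) = length c - 1"
  using vwalk_length_simp[of c] by (simp only: vwalk_length_def)

lemma vwalk_arcs_map: "vwalk_arcs (map f c) = map (map_prod f f) (vwalk_arcs c)"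
  by (induction c rule: vwalk_arcs.induct) auto

lemma pcas_vwalk_arcs: "c \<noteq> [] \<Longrightarrow> pcas (hd c) (vwalk_arcs c) (last c)"
  and pawalk_verts_vwalk_arcs: "c \<noteq> [] \<Longrightarrow> pawalk_verts (hd c) (vwalk_arcs c) = c"
  by (induction c rule: vwalk_arcs.induct) auto

lemma ucycle_vwalk_arcs:
  assumes "pair_graph G" "distinct c" "3 \<le> length c" "set c \<subseteq> pverts G"
    and "set (vwalk_arcs c) \<subseteq> parcs G" "(last c, hd c) \<in> parcs G"
  shows "ucycle G (vwalk_arcs (c @ [hd c]))"
proof -
  interpret pair_graph G by fact
  have c: "c \<noteq> []" using assms by auto
  then have arcs: "vwalk_arcs (c @ [hd c]) = vwalk_arcs c @ [(last c, hd c)]"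
    by (simp add: vwalk_arcs_append)
  have len: "length (vwalk_arcs (c @ [hd c])) = length c"
    by (simp add: length_vwalk_arcs)
  let ?p = "vwalk_arcs (c @ [hd c])"
  have "pcas (hd c) ?p (hd c)" and v: "pawalk_verts (hd c) ?p = c @ [hd c]"
    using pcas_vwalk_arcs[of "c @ [hd c]"] pawalk_verts_vwalk_arcs[of "c @ [hd c]"] c by simp_all
  then have "awalk (hd c) ?p (hd c)"
    using assms arcs c by (auto simp: awalk_def)
  moreover have "distinct (tl (pawalk_verts (hd c) ?p))"
    unfolding v using assms(2) c by (cases c) auto
  ultimately have "cycle ?p"
    using arcs by (auto simp: cycle_def)
  then show ?thesis
    using assms(3) len by (simp add: ucycle_def)
qed

lemma length_output_walk:
  "length (output_walk s) = regs s ''len''"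
  by (simp add: output_walk_def Let_def length_vwalk_arcs)

lemma pcas_nth:
  "pcas u p v \<Longrightarrow> pawalk_verts u p ! 0 = u \<and> pawalk_verts u p ! length p = v \<and>
    length (pawalk_verts u p) = Suc (length p) \<and>
    (\<forall>i<length p. p ! i = (pawalk_verts u p ! i, pawalk_verts u p ! Suc i))"
proof (induction p arbitrary: u)
  case (Cons a p)
  then have IH: "pawalk_verts (snd a) p ! 0 = snd a" "pawalk_verts (snd a) p ! length p = v"
    "length (pawalk_verts (snd a) p) = Suc (length p)"
    "\<forall>i<length p. p ! i = (pawalk_verts (snd a) p ! i, pawalk_verts (snd a) p ! Suc i)"
    and "fst a = u" by auto
  then show ?case
    by (auto simp: nth_Cons prod_eq_iff split: nat.splits)
qed simp

lemma girth_attained: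
  assumes "ucycle G p"
  obtains q where "ucycle G q" "length q = girth G"
proof -
  have "length p \<in> length ` {p. ucycle G p}" using assms by auto
  then have "girth G \<in> length ` {p. ucycle G p}"
    unfolding girth_def by (metis (no_types) Inf_nat_def1 empty_iff)
  then show ?thesis using that by auto
qed

lemma girth_le: "ucycle G p \<Longrightarrow> girth G \<le> length p"
  unfolding girth_def by (rule cINF_lower) auto

definition mutually_close :: "('a \<times> 'a) set \<Rightarrow> nat \<Rightarrow> 'a set \<Rightarrow> 'a set \<Rightarrow> bool" where
  "mutually_close E d X Y \<longleftrightarrow> (\<forall>x\<in>X. \<forall>y\<in>Y. \<exists>l\<le>d. (x, y) \<in> E ^^ l)"

text \<open>What the search argument keeps of a cycle: no finite forest contains a nonempty set of
  this kind.\<close>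

definition two_neighbours :: "('a \<times> 'a) set \<Rightarrow> 'a set \<Rightarrow> bool" where
  "two_neighbours E Z \<longleftrightarrow> (\<forall>z\<in>Z. \<exists>x\<in>Z. \<exists>y\<in>Z. x \<noteq> y \<and> (z, x) \<in> E \<and> (z, y) \<in> E)"

lemma ucycle_vertex_set:
  assumes "pair_graph G" "ucycle G p"
  obtains Z where "Z \<noteq> {}" "Z \<subseteq> pverts G" "two_neighbours (parcs G) Z"
    "mutually_close (parcs G) (length p - 1) Z Z"
proof -
  interpret pair_graph G by fact
  from assms(2) obtain u where u: "awalk u p u" "distinct (tl (pawalk_verts u p))"
    and g3: "3 \<le> length p"
    by (auto simp: ucycle_def cycle_def)
  then have "p \<noteq> []" by auto
  let ?g = "length p"
  define c where "c = pawalk_verts u p"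
  have cas: "pcas u p u" and sub: "set p \<subseteq> parcs G" using u by (auto simp: awalk_def)
  have c: "c ! 0 = u" "c ! ?g = u" "length c = Suc ?g" "\<And>i. i < ?g \<Longrightarrow> p ! i = (c ! i, c ! Suc i)"
    using pcas_nth[OF cas] by (auto simp: c_def)
  have arc: "(c ! i, c ! Suc i) \<in> parcs G" if "i < ?g" for i
    using c(4)[OF that] sub that by (metis nth_mem subsetD)
  have sym: "(x, y) \<in> parcs G \<Longrightarrow> (y, x) \<in> parcs G" for x y
    using pair_sym_arcs by (auto simp: symmetric_def sym_def)
  have inj: "i = j" if "c ! i = c ! j" "1 \<le> i" "i \<le> ?g" "1 \<le> j" "j \<le> ?g" for i j
  proof -
    have "tl c ! (i - 1) = c ! i" "tl c ! (j - 1) = c ! j"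
      using that c(3) by (auto simp: nth_tl)
    then have "i - 1 = j - 1"
      using that u(2) c(3) by (subst nth_eq_iff_index_eq[of "tl c", symmetric]) (auto simp: c_def)
    then show ?thesis using that by linarith
  qed
  have walk: "(c ! i, c ! (i + l)) \<in> parcs G ^^ l" if "i + l \<le> ?g" for i l
    using that
  proof (induction l)
    case (Suc l)
    then show ?case using arc[of "i + l"] by auto
  qed simp
  have symr: "(y, x) \<in> parcs G ^^ l" if "(x, y) \<in> parcs G ^^ l" for x y l
    using that
  proof (induction l arbitrary: y)
    case (Suc l)
    then obtain z where "(x, z) \<in> parcs G ^^ l" "(z, y) \<in> parcs G" by auto
    then show ?case using Suc.IH sym by (metis relpow_Suc_I2)
  qed simp
  show ?thesis
  proof
    \<comment> \<open>The walk visits its start at both ends and only its tail is distinct, so index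
      0 is left out.\<close>
    let ?Z = "(!) c ` {1..?g}"
    show "?Z \<noteq> {}" using g3 by auto
    show "?Z \<subseteq> pverts G"
    proof
      fix z assume "z \<in> ?Z"
      then obtain i where "i < ?g" "z = c ! Suc i"
        by (auto simp: image_iff) (metis Suc_le_D Suc_le_lessD One_nat_def)
      then show "z \<in> pverts G" using arc[of i] in_arcsD2 by auto
    qed
    show "two_neighbours (parcs G) ?Z"
      unfolding two_neighbours_def
    proof
      fix z assume "z \<in> ?Z"
      then obtain i where i: "1 \<le> i" "i \<le> ?g" "z = c ! i" by auto
      \<comment> \<open>Cyclic predecessor and successor of \<open>i\<close> in
        \<open>{1..?g}\<close>; they differ because \<open>?g \<ge> 3\<close>.\<close>
      define a where "a = (if i = 1 then ?g else i - 1)"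
      define b where "b = (if i = ?g then 1 else i + 1)"
      have ab: "a \<in> {1..?g}" "b \<in> {1..?g}" "a \<noteq> b" using i g3 by (auto simp: a_def b_def)
      have "(c ! a, c ! i) \<in> parcs G"
        using arc[of "i - 1"] i c \<open>p \<noteq> []\<close> by (auto simp: a_def)
      moreover have "(c ! i, c ! b) \<in> parcs G"
        using arc[of i] arc[of 0] i c g3 \<open>p \<noteq> []\<close> by (cases "i = ?g") (auto simp: b_def)
      moreover have "c ! a \<noteq> c ! b" using inj[of a b] ab by auto
      ultimately show "\<exists>x\<in>?Z. \<exists>y\<in>?Z. x \<noteq> y \<and> (z, x) \<in> parcs G \<and> (z, y) \<in> parcs G"
        using ab i sym by blast
    qed
    show "mutually_close (parcs G) (?g - 1) ?Z ?Z"
      unfolding mutually_close_def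
    proof (intro ballI)
      fix x y assume "x \<in> ?Z" "y \<in> ?Z"
      then obtain i j where i: "1 \<le> i" "i \<le> ?g" "x = c ! i" and j: "1 \<le> j" "j \<le> ?g" "y = c ! j"
        by auto
      show "\<exists>l\<le>?g - 1. (x, y) \<in> parcs G ^^ l"
      proof (cases "i \<le> j")
        case True
        then show ?thesis using walk[of i "j - i"] i j by (intro exI[of _ "j - i"]) auto
      next
        case False
        then show ?thesis using symr[OF walk[of j "i - j"]] i j by (intro exI[of _ "i - j"]) auto
      qed
    qed
  qed
qed

section \<open>Breadth-first search up to the first non-tree edge\<close>

locale csr_graph =
  fixes E :: "(nat \<times> nat) set" and n :: nat and off adj :: "nat \<Rightarrow> nat"
  assumes sym: "(x, y) \<in> E \<Longrightarrow> (y, x) \<in> E"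
    and loopfree: "(x, x) \<notin> E"
    and in_range: "(x, y) \<in> E \<Longrightarrow> x < n"
    and conn: "x < n \<Longrightarrow> y < n \<Longrightarrow> (x, y) \<in> E\<^sup>*"
    and off_mono: "v < n \<Longrightarrow> off v \<le> off (Suc v)"
    and adj: "v < n \<Longrightarrow> bij_betw adj {off v..<off (Suc v)} {u. (v, u) \<in> E}"
begin

definition in_tree :: "nat \<Rightarrow> (nat \<Rightarrow> nat) \<Rightarrow> (nat \<Rightarrow> nat) \<Rightarrow> nat \<Rightarrow> nat \<Rightarrow> bool" where
  "in_tree t Q par i y \<longleftrightarrow> (\<exists>j<t. Q j = y \<and> tree_adjacent par i j)"

text \<open>Records that expanding the first \<open>H\<close> queue entries met no non-tree edge:
  every edge there leads to the parent or to a child.\<close>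

definition scanned :: "nat \<Rightarrow> nat \<Rightarrow> (nat \<Rightarrow> nat) \<Rightarrow> (nat \<Rightarrow> nat) \<Rightarrow> bool" where
  "scanned H t Q par \<longleftrightarrow> (\<forall>i<H. \<forall>y. (Q i, y) \<in> E \<longrightarrow> in_tree t Q par i y)"

text \<open>Monotonicity of the parent indices is what makes depth nondecreasing along the queue.\<close>

definition queue_inv :: "nat \<Rightarrow> nat \<Rightarrow> (nat \<Rightarrow> nat) \<Rightarrow> (nat \<Rightarrow> nat) \<Rightarrow> (nat \<Rightarrow> nat) \<Rightarrow> bool" where
  "queue_inv v t Q par pos \<longleftrightarrow>
    0 < t \<and> Q 0 = v \<and> par 0 = 0 \<and>
    (\<forall>i<t. Q i < n \<and> pos (Q i) = i) \<and>
    (\<forall>i<t. 0 < i \<longrightarrow> par i < i \<and> (Q (par i), Q i) \<in> E) \<and>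
    (\<forall>i j. 0 < i \<longrightarrow> i \<le> j \<longrightarrow> j < t \<longrightarrow> par i \<le> par j)"

text \<open>The list of the head has been scanned up to \<open>e\<close>. The last clause ties the
  children of the head to scanned positions; as an adjacency list has no repetitions, the next edge
  cannot lead to a child.\<close>

definition bfs_inv ::
    "nat \<Rightarrow> nat \<Rightarrow> nat \<Rightarrow> nat \<Rightarrow> (nat \<Rightarrow> nat) \<Rightarrow> (nat \<Rightarrow> nat) \<Rightarrow> (nat \<Rightarrow> nat) \<Rightarrow> bool" where
  "bfs_inv v h t e Q par pos \<longleftrightarrow>
    queue_inv v t Q par pos \<and> h < t \<and> scanned h t Q par \<and>
    (\<forall>i<t. 0 < i \<longrightarrow> par i \<le> h) \<and>
    off (Q h) \<le> e \<and> e \<le> off (Suc (Q h)) \<and>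
    (\<forall>p\<in>{off (Q h)..<e}. in_tree t Q par h (adj p)) \<and>
    (\<forall>i<t. 0 < i \<and> par i = h \<longrightarrow> Q i \<in> adj ` {off (Q h)..<e})"

text \<open>
  Grows with every step of the search, which yields both termination and the time bound. The last
  summand pays for the only scanned edge that neither visits a vertex nor ends the search: the edge
  back to the parent, which occurs once in the adjacency list.
\<close>

definition progress :: "nat \<Rightarrow> nat \<Rightarrow> nat \<Rightarrow> (nat \<Rightarrow> nat) \<Rightarrow> (nat \<Rightarrow> nat) \<Rightarrow> nat" where
  "progress h t e Q par = t + 2 * h + of_bool (Q (par h) \<in> adj ` {off (Q h)..<e})"

lemma queue_invD:
  assumes "queue_inv v t Q par pos"
  shows "0 < t" "Q 0 = v" "par 0 = 0" "\<And>i. i < t \<Longrightarrow> Q i < n" "\<And>i. i < t \<Longrightarrow> pos (Q i) = i"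
    "\<And>i. i < t \<Longrightarrow> 0 < i \<Longrightarrow> par i < i" "\<And>i. i < t \<Longrightarrow> 0 < i \<Longrightarrow> (Q (par i), Q i) \<in> E"
    "\<And>i j. 0 < i \<Longrightarrow> i \<le> j \<Longrightarrow> j < t \<Longrightarrow> par i \<le> par j"
  using assms by (auto simp: queue_inv_def)

lemma adj_E:
  assumes "v < n" "off v \<le> e" "e < off (Suc v)"
  shows "(v, adj e) \<in> E"
  using adj[OF assms(1)] assms by (auto dest!: bij_betwE)

lemma adj_inj:
  assumes "v < n" "off v \<le> e" "e < e'" "e' < off (Suc v)"
  shows "adj e \<noteq> adj e'"
  using bij_betw_imp_inj_on[OF adj[OF assms(1)]] assms by (auto dest: inj_onD)

lemma bfs_inv_init:
  assumes "v < n"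
  shows "bfs_inv v 0 1 (off v) (Q(0 := v)) (par(0 := 0)) (pos(v := 0))"
  using assms off_mono by (auto simp: bfs_inv_def queue_inv_def scanned_def)

lemma bfs_inv_scanned_Suc:
  assumes "bfs_inv v h t e Q par pos" "e = off (Suc (Q h))"
  shows "scanned (Suc h) t Q par"
  unfolding scanned_def
proof (intro allI impI)
  fix i y assume i: "i < Suc h" and y: "(Q i, y) \<in> E"
  show "in_tree t Q par i y"
  proof (cases "i < h")
    case True
    then show ?thesis using assms y by (auto simp: bfs_inv_def scanned_def)
  next
    case False
    with i have "i = h" by simp
    moreover have "Q h < n" using assms by (auto simp: bfs_inv_def queue_inv_def)
    ultimately have "y \<in> adj ` {off (Q h)..<e}"
      using adj[of "Q h"] y assms(2) by (auto simp: bij_betw_def)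
    then show ?thesis using assms(1) \<open>i = h\<close> by (auto simp: bfs_inv_def)
  qed
qed

lemma bfs_inv_advance:
  assumes "bfs_inv v h t e Q par pos" "e = off (Suc (Q h))" "Suc h < t"
  shows "bfs_inv v (Suc h) t (off (Q (Suc h))) Q par pos"
    and "progress h t e Q par < progress (Suc h) t (off (Q (Suc h))) Q par"
proof -
  have "par i \<le> h" if "i < t" "0 < i" for i
    using assms that by (auto simp: bfs_inv_def)
  moreover from this have "par i \<noteq> Suc h" if "i < t" "0 < i" for i
    using that by fastforce
  moreover have "queue_inv v t Q par pos" and "Q (Suc h) < n"
    using assms by (auto simp: bfs_inv_def queue_inv_def)
  ultimately show "bfs_inv v (Suc h) t (off (Q (Suc h))) Q par pos"
    using assms(3) bfs_inv_scanned_Suc[OF assms(1,2)] off_mono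
    by (auto simp: bfs_inv_def le_SucI)
\<comment> \<open>Advancing the head gains 2 and can lose only the indicator, which is at most
  1.\<close>
qed (simp add: progress_def)

lemma bfs_inv_skip:
  assumes "bfs_inv v h t e Q par pos" "e < off (Suc (Q h))" "adj e = Q (par h)"
  shows "bfs_inv v h t (Suc e) Q par pos"
    and "progress h t e Q par < progress h t (Suc e) Q par"
proof -
  have h: "h < t" "Q h < n" "off (Q h) \<le> e" and q: "queue_inv v t Q par pos"
    using assms by (auto simp: bfs_inv_def queue_inv_def)
  have edge: "(Q h, adj e) \<in> E" using adj_E h assms by blast
  \<comment> \<open>At the root \<open>par 0 = 0\<close>, so the skipped edge would be a
    loop.\<close>
  have "0 < h"
    using edge assms(3) queue_invD(3)[OF q] loopfree by (cases "h = 0") auto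
  then have "in_tree t Q par h (adj e)"
    using assms(3) queue_invD(6)[OF q, of h] h(1)
    by (auto simp: in_tree_def tree_adjacent_def intro!: exI[of _ "par h"])
  then show "bfs_inv v h t (Suc e) Q par pos"
    using assms h by (auto simp: bfs_inv_def atLeastLessThanSuc)
  have "Q (par h) \<notin> adj ` {off (Q h)..<e}"
    using adj_inj[OF h(2)] assms(2,3) by force
  then show "progress h t e Q par < progress h t (Suc e) Q par"
    using assms(3) h by (auto simp: progress_def atLeastLessThanSuc)
qed

lemma in_tree_push:
  assumes "in_tree t Q par i y" "i < t" "queue_inv v t Q par pos"
  shows "in_tree (Suc t) (Q(t := x)) (par(t := h)) i y"
proof -
  from assms(1) obtain j where "j < t" "Q j = y" "tree_adjacent par i j"
    by (auto simp: in_tree_def)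
  then show ?thesis
    using assms(2) by (auto simp: in_tree_def tree_adjacent_def intro!: exI[of _ j])
qed

lemma bfs_inv_push:
  assumes inv: "bfs_inv v h t e Q par pos" and e: "e < off (Suc (Q h))"
    and new: "\<not> (pos x < t \<and> Q (pos x) = x)" and x: "adj e = x"
  shows "bfs_inv v h (Suc t) (Suc e) (Q(t := x)) (par(t := h)) (pos(x := t))"
    and "progress h t e Q par < progress h (Suc t) (Suc e) (Q(t := x)) (par(t := h))"
proof -
  have h: "h < t" "Q h < n" "off (Q h) \<le> e" and q: "queue_inv v t Q par pos"
    and sc: "scanned h t Q par"
    using inv by (auto simp: bfs_inv_def queue_inv_def)
  note qD = queue_invD[OF q]
  have edge: "(Q h, x) \<in> E" using adj_E h e x by blast
  then have xn: "x < n" using sym in_range by blast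
  \<comment> \<open>A queued vertex always passes the visited test, because
    \<open>pos (Q i) = i\<close>; hence failing the test means being new.\<close>
  have fresh: "Q i \<noteq> x" if "i < t" for i
    using new qD(5)[OF that] that by auto
  have ph: "par h < t" using qD(3) qD(6)[of h] h by (cases "h = 0") auto
  have parh: "par i \<le> h" if "i < t" "0 < i" for i
    using inv that by (auto simp: bfs_inv_def)
  have "queue_inv v (Suc t) (Q(t := x)) (par(t := h)) (pos(x := t))"
    unfolding queue_inv_def
  proof (intro conjI allI impI)
    fix i assume "i < Suc t" "0 < i"
    then show "(par(t := h)) i < i" using qD(6)[of i] h by (cases "i = t") auto
    show "((Q(t := x)) ((par(t := h)) i), (Q(t := x)) i) \<in> E"
      using qD(6)[of i] qD(7)[of i] edge h \<open>i < Suc t\<close> \<open>0 < i\<close> by (cases "i = t") auto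
  next
    fix i j assume "0 < i" "i \<le> j" "j < Suc t"
    then show "(par(t := h)) i \<le> (par(t := h)) j"
      using qD(8)[of i j] parh[of i] by (cases "j = t"; cases "i = t") auto
  next
    fix i assume "i < Suc t"
    then show "(Q(t := x)) i < n" "(pos(x := t)) ((Q(t := x)) i) = i"
      using qD(4,5)[of i] fresh[of i] xn by (cases "i = t"; simp)+
  qed (use qD in auto)
  moreover have "scanned h (Suc t) (Q(t := x)) (par(t := h))"
    using sc in_tree_push[OF _ _ q] h by (auto simp: scanned_def)
  moreover have "in_tree (Suc t) (Q(t := x)) (par(t := h)) h (adj p)" if "p \<in> {off (Q h)..<Suc e}" for p
  proof (cases "p = e")
    case True
    then show ?thesis using x h by (auto simp: in_tree_def tree_adjacent_def intro!: exI[of _ t])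
  next
    case False
    then show ?thesis using that inv h by (intro in_tree_push[OF _ _ q]) (auto simp: bfs_inv_def)
  qed
  moreover have "\<forall>i<Suc t. 0 < i \<and> (par(t := h)) i = h \<longrightarrow>
      (Q(t := x)) i \<in> adj ` {off ((Q(t := x)) h)..<Suc e}"
  proof (intro allI impI)
    fix i assume i: "i < Suc t" "0 < i \<and> (par(t := h)) i = h"
    show "(Q(t := x)) i \<in> adj ` {off ((Q(t := x)) h)..<Suc e}"
    proof (cases "i = t")
      case True
      then show ?thesis using x h by auto
    next
      case False
      then have "Q i \<in> adj ` {off (Q h)..<e}" using i inv by (auto simp: bfs_inv_def)
      then show ?thesis using False h by auto
    qed
  qed
  ultimately show "bfs_inv v h (Suc t) (Suc e) (Q(t := x)) (par(t := h)) (pos(x := t))"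
    using h e parh by (auto simp: bfs_inv_def less_Suc_eq)
  show "progress h t e Q par < progress h (Suc t) (Suc e) (Q(t := x)) (par(t := h))"
    using h ph by (auto simp: progress_def atLeastLessThanSuc)
qed

text \<open>A visited endpoint other than the parent is no child of the head either, since the edge
  to a child was scanned earlier and adjacency lists do not repeat. So this edge closes a cycle with
  the tree path.\<close>

lemma bfs_inv_not_tree_adjacent:
  assumes inv: "bfs_inv v h t e Q par pos" and e: "e < off (Suc (Q h))"
    and x: "adj e = x" "pos x < t" "Q (pos x) = x" "x \<noteq> Q (par h)"
  shows "h \<noteq> pos x" "\<not> tree_adjacent par h (pos x)"
proof -
  have h: "h < t" "Q h < n" "off (Q h) \<le> e" and q: "queue_inv v t Q par pos"
    using inv by (auto simp: bfs_inv_def queue_inv_def)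
  have edge: "(Q h, x) \<in> E" using adj_E h e x by blast
  then show "h \<noteq> pos x" using x loopfree by auto
  have "\<not> (0 < pos x \<and> par (pos x) = h)"
  proof
    assume "0 < pos x \<and> par (pos x) = h"
    then have "Q (pos x) \<in> adj ` {off (Q h)..<e}"
      using inv x(2) unfolding bfs_inv_def by blast
    then have "x \<in> adj ` {off (Q h)..<e}" using x(3) by simp
    then show False using adj_inj[OF h(2)] e x by force
  qed
  then show "\<not> tree_adjacent par h (pos x)"
    using x by (auto simp: tree_adjacent_def)
qed

text \<open>Take the node of \<open>Z\<close> with the largest queue position. Its two neighbours in
  \<open>Z\<close> come earlier, but a scanned edge to an earlier node leads to the parent, which is
  unique.\<close>

lemma scanned_no_cycle:
  assumes q: "queue_inv v t Q par pos" and sc: "scanned H t Q par" and "H \<le> t"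
    and Z: "Z \<subseteq> Q ` {..<H}" "Z \<noteq> {}" "two_neighbours E Z"
  shows False
proof -
  note qD = queue_invD[OF q]
  let ?I = "{i. i < H \<and> Q i \<in> Z}"
  define i where "i = Max ?I"
  have "?I \<noteq> {}" using Z by auto
  then have "i \<in> ?I" unfolding i_def by (intro Max_in) auto
  then have i: "i < H" "Q i \<in> Z" by auto
  have *: "0 < i \<and> Q (par i) = y" if y: "y \<in> Z" "(Q i, y) \<in> E" for y
  proof -
    from y Z obtain k where k: "k < H" "Q k = y" by auto
    then have "k \<in> ?I" using y by auto
    then have "k \<le> i" unfolding i_def by (intro Max_ge) auto
    moreover have "k \<noteq> i" using k y loopfree by auto
    ultimately have ki: "k < i" by simp
    from sc i y obtain j where j: "j < t" "Q j = y" "tree_adjacent par i j"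
      by (auto simp: scanned_def in_tree_def)
    have "j = k" using qD(5)[of j] qD(5)[of k] j k \<open>H \<le> t\<close> by auto
    then show ?thesis using j ki qD(6)[of j] by (auto simp: tree_adjacent_def)
  qed
  from Z(3) i(2) obtain x y where "x \<in> Z" "y \<in> Z" "x \<noteq> y" "(Q i, x) \<in> E" "(Q i, y) \<in> E"
    by (auto simp: two_neighbours_def)
  then show False using * by metis
qed

text \<open>If the queue were exhausted, connectivity would put all of \<open>Z\<close> among
  expanded nodes whose edges are all tree edges. The program may therefore advance the head without
  testing for an empty queue.\<close>

lemma bfs_inv_not_exhausted:
  assumes inv: "bfs_inv v h t e Q par pos" "e = off (Suc (Q h))"
    and Z: "Z \<subseteq> {..<n}" "Z \<noteq> {}" "two_neighbours E Z"
  shows "Suc h < t"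
proof (rule ccontr)
  assume "\<not> Suc h < t"
  with inv have t: "t = Suc h" by (auto simp: bfs_inv_def)
  have q: "queue_inv v t Q par pos" using inv by (auto simp: bfs_inv_def)
  have sc: "scanned t t Q par" using bfs_inv_scanned_Suc[OF inv] t by simp
  have "z \<in> Q ` {..<t}" if "(v, z) \<in> E\<^sup>*" for z
    using that
  proof induction
    case base
    show ?case using queue_invD(1,2)[OF q] by auto
  next
    case (step y z)
    then show ?case using sc by (auto simp: scanned_def in_tree_def)
  qed
  moreover have "v < n" using queue_invD(1,2,4)[OF q] by metis
  ultimately have "Z \<subseteq> Q ` {..<t}" using conn Z by blast
  then show False using scanned_no_cycle[OF q sc] Z by blast
qed

section \<open>Depth in the search tree and distance from the root\<close>

lemma depth_mono:
  assumes q: "queue_inv v t Q par pos"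
  shows "i \<le> j \<Longrightarrow> j < t \<Longrightarrow> depth par i \<le> depth par j"
proof (induction j arbitrary: i rule: less_induct)
  case (less j)
  note qD = queue_invD[OF q]
  show ?case
  proof (cases "i = 0")
    case True
    then show ?thesis by (simp add: depth.simps)
  next
    case False
    \<comment> \<open>\<open>par\<close> is nondecreasing on positive positions, so the claim passes
      to the parents.\<close>
    then have "depth par (par i) \<le> depth par (par j)"
      using less qD(6)[of j] qD(8)[of i j] by (intro less.IH) auto
    then show ?thesis
      using False less.prems qD(6)[of i] qD(6)[of j] by (subst (1 2) depth.simps) auto
  qed
qed

lemma depth_walk:
  assumes q: "queue_inv v t Q par pos"
  shows "i < t \<Longrightarrow> (v, Q i) \<in> E ^^ depth par i"
proof (induction i rule: less_induct)
  case (less i)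
  note qD = queue_invD[OF q]
  show ?case
  proof (cases "i = 0")
    case True
    then show ?thesis using qD by (simp add: depth.simps)
  next
    case False
    then have "(v, Q (par i)) \<in> E ^^ depth par (par i)"
      using less qD(6)[of i] by (intro less.IH) auto
    then show ?thesis
      using False less.prems qD(6,7)[of i] by (subst depth.simps) auto
  qed
qed

text \<open>The last but one vertex of the walk is queued at a depth below that of the head. By
  \<open>depth_mono\<close> it precedes the head, so all its edges are tree edges and its neighbours
  are queued too.\<close>

lemma visited_if_close:
  assumes q: "queue_inv v t Q par pos" and sc: "scanned h t Q par" and h: "h < t"
  shows "l < depth par h \<Longrightarrow> (v, y) \<in> E ^^ l \<Longrightarrow> \<exists>j<t. Q j = y \<and> depth par j \<le> l"
proof (induction l arbitrary: y)
  case 0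
  then show ?case using queue_invD(1,2)[OF q] by (auto simp: depth.simps intro!: exI[of _ 0])
next
  case (Suc l)
  then obtain x where x: "(v, x) \<in> E ^^ l" "(x, y) \<in> E" by auto
  with Suc obtain i where i: "i < t" "Q i = x" "depth par i \<le> l" by auto
  then have "i < h" using Suc.prems depth_mono[OF q, of h i] by (cases "i < h") auto
  then obtain j where j: "j < t" "Q j = y" "tree_adjacent par i j"
    using sc x i by (auto simp: scanned_def in_tree_def)
  \<comment> \<open>A tree neighbour is a child, one level deeper, or the parent, which has a
    smaller position and hence no larger depth.\<close>
  have "depth par j \<le> Suc (depth par i)"
  proof (cases "0 < j \<and> par j = i")
    case True
    then show ?thesis by (subst depth.simps) auto
  next
    case False
    then show ?thesis
      using j i queue_invD(6)[OF q, of i] depth_mono[OF q, of j i]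
      by (auto simp: tree_adjacent_def)
  qed
  then have "depth par j \<le> Suc l" using i by linarith
  then show ?case using j by blast
qed

text \<open>If the head were deeper than \<open>d\<close>, all of \<open>Z\<close> would have been
  expanded before it, contradicting \<open>scanned_no_cycle\<close>.\<close>

lemma depth_le:
  assumes inv: "bfs_inv v h t e Q par pos"
    and Z: "Z \<noteq> {}" "two_neighbours E Z" "mutually_close E d {v} Z"
  shows "depth par h \<le> d"
proof (rule ccontr)
  assume deep: "\<not> ?thesis"
  have q: "queue_inv v t Q par pos" and h: "h < t" and sc: "scanned h t Q par"
    using inv by (auto simp: bfs_inv_def)
  have "Z \<subseteq> Q ` {..<h}"
  proof
    fix z assume "z \<in> Z"
    then obtain l where l: "l \<le> d" "(v, z) \<in> E ^^ l"
      using Z(3) by (auto simp: mutually_close_def)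
    then obtain j where j: "j < t" "Q j = z" "depth par j \<le> l"
      using visited_if_close[OF q sc h, of l z] deep by auto
    then have "j < h" using depth_mono[OF q, of h j] deep l by (cases "j < h") auto
    then show "z \<in> Q ` {..<h}" using j by auto
  qed
  then show False using scanned_no_cycle[OF q sc _ _ Z(1,2)] h by auto
qed

lemma queue_depth_le:
  assumes inv: "bfs_inv v h t e Q par pos" and "depth par h \<le> d" "i < t"
  shows "depth par i \<le> Suc d"
proof -
  have q: "queue_inv v t Q par pos" and h: "h < t"
    using inv by (auto simp: bfs_inv_def)
  show ?thesis
  proof (cases "i = 0")
    case False
    then have "par i \<le> h" using inv assms by (auto simp: bfs_inv_def)
    then have "depth par (par i) \<le> d" using depth_mono[OF q _ h] assms by fastforce
    then show ?thesis by (subst depth.simps) auto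
  qed (simp add: depth.simps)
qed

text \<open>Queued vertices have depth at most \<open>d + 1\<close>, and \<open>v\<close> is within
  \<open>d\<close> of \<open>Z\<close>, so the route through \<open>v\<close> has at most
  \<open>2 * d + 1\<close> arcs. For \<open>d = 2 ^ i * g - 1\<close> this is
  \<open>2 ^ (i + 1) * g - 1\<close>, the radius of the next scale.\<close>

lemma bfs_ball:
  assumes inv: "bfs_inv v h t e Q par pos"
    and Z: "Z \<noteq> {}" "two_neighbours E Z" "mutually_close E d {v} Z"
  shows "\<exists>S. S \<subseteq> {..<n} \<and> card S = t \<and> mutually_close E (2 * d + 1) S Z"
proof (intro exI conjI)
  have q: "queue_inv v t Q par pos" using inv by (auto simp: bfs_inv_def)
  note qD = queue_invD[OF q]
  show "Q ` {..<t} \<subseteq> {..<n}" using qD by auto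
  have "inj_on Q {..<t}" using qD(5) by (metis inj_onI lessThan_iff)
  then show "card (Q ` {..<t}) = t" by (simp add: card_image)
  have symr: "(y, x) \<in> E ^^ l" if "(x, y) \<in> E ^^ l" for x y l
    using that
  proof (induction l arbitrary: y)
    case (Suc l)
    then obtain z where "(x, z) \<in> E ^^ l" "(z, y) \<in> E" by auto
    then show ?case using Suc.IH sym by (metis relpow_Suc_I2)
  qed simp
  show "mutually_close E (2 * d + 1) (Q ` {..<t}) Z"
    unfolding mutually_close_def
  proof (intro ballI)
    fix x z assume "x \<in> Q ` {..<t}" and z: "z \<in> Z"
    then obtain i where i: "i < t" "x = Q i" by auto
    have "depth par i \<le> Suc d" using queue_depth_le[OF inv depth_le[OF inv Z]] i by blast
    moreover obtain l where "l \<le> d" "(v, z) \<in> E ^^ l"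
      using Z(3) z by (auto simp: mutually_close_def)
    moreover have "(x, v) \<in> E ^^ depth par i" using symr depth_walk[OF q] i by blast
    ultimately show "\<exists>l\<le>2 * d + 1. (x, z) \<in> E ^^ l"
      by (intro exI[of _ "depth par i + l"]) (auto simp: relpow_add)
  qed
qed

end

section \<open>The program for a single search\<close>

text \<open>
  The array \<open>pos\<close> is never cleared between searches. A vertex \<open>x\<close> counts as visited iff \<open>pos x < t\<close>
  and \<open>Q (pos x) = x\<close>, so stale entries do no harm and starting a search takes constant time.
\<close>

definition visit :: com where
  "visit =
    Seq (Store ''Q'' (Reg ''t'') (Reg ''x''))
    (Seq (Store ''par'' (Reg ''t'') (Reg ''h''))
    (Seq (Store ''pos'' (Reg ''x'') (Reg ''t''))
    (Assign ''t'' (Add (Reg ''t'') (Const 1)))))"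

definition scan_edge :: com where
  "scan_edge =
    Seq (Assign ''x'' (Load ''adj'' (Reg ''e'')))
    (Seq (Assign ''e'' (Add (Reg ''e'') (Const 1)))
    (Cond (Eq (Reg ''x'') (Load ''Q'' (Load ''par'' (Reg ''h'')))) Skip
    (Cond (BAnd (Less (Load ''pos'' (Reg ''x'')) (Reg ''t''))
                (Eq (Load ''Q'' (Load ''pos'' (Reg ''x''))) (Reg ''x'')))
      (Assign ''fin'' (Const 1))
      visit)))"

definition bfs_step :: com where
  "bfs_step =
    Cond (Eq (Reg ''e'') (Load ''off'' (Add (Load ''Q'' (Reg ''h'')) (Const 1))))
      (Seq (Assign ''h'' (Add (Reg ''h'') (Const 1)))
           (Assign ''e'' (Load ''off'' (Load ''Q'' (Reg ''h'')))))
      scan_edge"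

definition bfs :: com where
  "bfs =
    Seq (Store ''Q'' (Const 0) (Reg ''v''))
    (Seq (Store ''par'' (Const 0) (Const 0))
    (Seq (Store ''pos'' (Reg ''v'') (Const 0))
    (Seq (Assign ''h'' (Const 0))
    (Seq (Assign ''t'' (Const 1))
    (Seq (Assign ''e'' (Load ''off'' (Reg ''v'')))
    (Seq (Assign ''fin'' (Const 0))
    (While (BAnd (Eq (Reg ''fin'') (Const 0)) (Less (Reg ''t'') (Reg ''lim''))) bfs_step)))))))"

definition measure_cycle :: com where
  "measure_cycle =
    Seq (Assign ''i'' (Reg ''h''))
    (Seq (Assign ''j'' (Load ''pos'' (Reg ''x'')))
    (Seq (Assign ''b'' (Const 0))
    (While (BNot (Eq (Reg ''i'') (Reg ''j'')))
      (Seq (Assign ''b'' (Add (Reg ''b'') (Const 1)))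
        (Cond (Less (Reg ''j'') (Reg ''i''))
          (Assign ''i'' (Load ''par'' (Reg ''i'')))
          (Assign ''j'' (Load ''par'' (Reg ''j''))))))))"

text \<open>
  Parents have smaller queue indices than their children, so replacing the larger of \<open>i\<close> and \<open>j\<close> by its
  parent leads both to their lowest common ancestor. The output is filled from both ends.
\<close>

definition write_cycle :: com where
  "write_cycle =
    Seq (Assign ''len'' (Add (Reg ''b'') (Const 1)))
    (Seq (Assign ''a'' (Const 0))
    (Seq (Assign ''i'' (Reg ''h''))
    (Seq (Assign ''j'' (Load ''pos'' (Reg ''x'')))
    (Seq (While (BNot (Eq (Reg ''i'') (Reg ''j'')))
      (Cond (Less (Reg ''j'') (Reg ''i''))
        (Seq (Store ''out'' (Reg ''a'') (Load ''Q'' (Reg ''i'')))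
        (Seq (Assign ''a'' (Add (Reg ''a'') (Const 1)))
          (Assign ''i'' (Load ''par'' (Reg ''i'')))))
        (Seq (Store ''out'' (Reg ''b'') (Load ''Q'' (Reg ''j'')))
        (Seq (Assign ''b'' (Sub (Reg ''b'') (Const 1)))
          (Assign ''j'' (Load ''par'' (Reg ''j'')))))))
    (Store ''out'' (Reg ''a'') (Load ''Q'' (Reg ''i'')))))))"

definition search :: com where
  "search =
    Seq bfs
    (Cond (Eq (Reg ''fin'') (Const 0)) Skip
      (Seq measure_cycle
        (Cond (Less (Add (Reg ''b'') (Const 1)) (Reg ''len'')) write_cycle Skip)))"

lemmas program_defs = visit_def scan_edge_def bfs_step_def bfs_def measure_cycle_def
  write_cycle_def search_def

text \<open>\<open>Z\<close> remains abstract here; the vertex set of a shortest cycle is supplied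
  only in the final theorem.\<close>

locale girth_input = csr_graph "parcs G" n off adj
  for G :: "nat pair_pre_digraph" and n :: nat and off adj :: "nat \<Rightarrow> nat" +
  fixes w :: nat and Z :: "nat set"
  assumes pair_graph: "pair_graph G"
    and verts: "pverts G = {..<n}"
    and off_le: "v \<le> n \<Longrightarrow> off v \<le> n * n"
    and word: "n ^ 4 \<le> 2 ^ w"
    and Z: "Z \<subseteq> {..<n}" "Z \<noteq> {}" "two_neighbours (parcs G) Z"
    and n_ge: "3 \<le> n"
begin

text \<open>The range up to \<open>n * n + n\<close> covers offsets, doublings, powers cut off
  beyond \<open>n\<close>, search limits and sample counts; by \<open>3 \<le> n\<close> it lies
  below \<open>n ^ 4\<close>.\<close>

lemma take_bit_le: "x \<le> n * n + n \<Longrightarrow> take_bit w x = x"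
proof -
  assume "x \<le> n * n + n"
  also have "\<dots> < 3 * (n * n)" using n_ge by simp
  also have "\<dots> \<le> n * n * (n * n)"
    using n_ge by (intro mult_right_mono) (auto intro: order_trans[of _ "3 * 3"] mult_mono)
  also have "\<dots> = n ^ 4" by (simp add: numeral_eq_Suc)
  also have "\<dots> \<le> 2 ^ w" by (rule word)
  finally show ?thesis by (rule take_bit_nat_eq_self)
qed

lemma take_bit_Suc_le: "x < n * n + n \<Longrightarrow> take_bit w (Suc x) = Suc x"
  by (rule take_bit_le) simp

lemma take_bit_Suc_le_n: "x \<le> n \<Longrightarrow> take_bit w (Suc x) = Suc x"
proof -
  assume "x \<le> n"
  moreover have "0 < n * n" using n_ge by simp
  ultimately show ?thesis by (intro take_bit_Suc_le) linarith
qed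

lemma w_pos [simp]: "0 < w"
proof (rule ccontr)
  assume "\<not> 0 < w"
  with take_bit_le[of 1] n_ge show False by simp
qed

definition env :: "state \<Rightarrow> bool" where
  "env s \<longleftrightarrow> regs s ''n'' = n \<and> arrs s ''off'' = off \<and> arrs s ''adj'' = adj"

text \<open>The position is existentially quantified because the program has already moved
  \<open>e\<close> past the edge that closes the cycle, and \<open>bfs_inv\<close> fails
  there.\<close>

definition bfs_found :: "nat \<Rightarrow> nat \<Rightarrow> nat \<Rightarrow> nat \<Rightarrow> (nat \<Rightarrow> nat) \<Rightarrow> (nat \<Rightarrow> nat) \<Rightarrow> (nat \<Rightarrow> nat) \<Rightarrow> bool" where
  "bfs_found v h t x Q par pos \<longleftrightarrow>
    (\<exists>e. bfs_inv v h t e Q par pos \<and> e < off (Suc (Q h)) \<and> adj e = x \<and>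
      pos x < t \<and> Q (pos x) = x \<and> x \<noteq> Q (par h))"

lemma queue_inv_le_n: "queue_inv v t Q par pos \<Longrightarrow> t \<le> n"
proof -
  assume q: "queue_inv v t Q par pos"
  have "inj_on Q {..<t}" using queue_invD(5)[OF q] by (metis inj_onI lessThan_iff)
  moreover have "Q ` {..<t} \<subseteq> {..<n}" using queue_invD(4)[OF q] by auto
  ultimately show ?thesis using card_inj_on_le[of Q "{..<t}" "{..<n}"] by simp
qed

text \<open>Amortised accounting: one iteration costs at most 12 and raises \<open>progress\<close>,
  which never exceeds \<open>3 * m\<close>. The additional 12 pays for the iteration that sets
  \<open>fin\<close>.\<close>

definition loop_inv :: "nat \<Rightarrow> nat \<Rightarrow> nat \<Rightarrow> state \<Rightarrow> bool" where
  "loop_inv v m T s \<longleftrightarrow>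
    (let h = regs s ''h''; t = regs s ''t''; e = regs s ''e'';
         Q = arrs s ''Q''; par = arrs s ''par''; pos = arrs s ''pos'' in
      h < t \<and> t \<le> m \<and>
      (if regs s ''fin'' = 0
       then bfs_inv v h t e Q par pos \<and> time s \<le> T + 12 * progress h t e Q par
       else bfs_found v h t (regs s ''x'') Q par pos \<and> time s \<le> T + 36 * m + 12))"

lemma progress_le: "h < t \<Longrightarrow> t \<le> m \<Longrightarrow> progress h t e Q par \<le> 3 * m"
  by (auto simp: progress_def of_bool_def)

lemma wp_bfs_step:
  assumes inv: "loop_inv v m T s" and fin: "regs s ''fin'' = 0" and t: "regs s ''t'' < m"
    and env: "env s"
  shows "wp w bfs_step (tick s) (\<lambda>s'. loop_inv v m T s' \<and>
    (regs s' ''fin'' = 0 \<longrightarrow>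
      progress (regs s ''h'') (regs s ''t'') (regs s ''e'') (arrs s ''Q'') (arrs s ''par'') <
      progress (regs s' ''h'') (regs s' ''t'') (regs s' ''e'') (arrs s' ''Q'') (arrs s' ''par'')))"
proof -
  define h t e Q par pos where d: "h = regs s ''h''" "t = regs s ''t''" "e = regs s ''e''"
    "Q = arrs s ''Q''" "par = arrs s ''par''" "pos = arrs s ''pos''"
  have I: "bfs_inv v h t e Q par pos" and T: "time s \<le> T + 12 * progress h t e Q par"
    and lt: "t < m"
    using inv fin t by (auto simp: loop_inv_def d Let_def)
  have h: "h < t" "Q h < n" "off (Q h) \<le> e" "e \<le> off (Suc (Q h))" and q: "queue_inv v t Q par pos"
    using I by (auto simp: bfs_inv_def queue_inv_def)
  have tn: "t \<le> n" using queue_inv_le_n[OF q] .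
  have en: "e \<le> n * n" using h off_le[of "Suc (Q h)"] by simp
  have nn: "n \<le> n * n" by simp
  have tb: "take_bit w (Suc (Q h)) = Suc (Q h)" "take_bit w (Suc h) = Suc h"
      "take_bit w (Suc t) = Suc t" "take_bit w (Suc e) = Suc e"
    using h tn en n_ge nn by (intro take_bit_Suc_le; linarith)+
  note env' = env[unfolded env_def]
  show ?thesis
  proof (cases "e = off (Suc (Q h))")
    case True
    have "Suc h < t" using bfs_inv_not_exhausted[OF I True Z] .
    then show ?thesis
      using bfs_inv_advance[OF I True] T lt env' fin tb True
      by (simp add: bfs_step_def loop_inv_def Let_def d[symmetric])
  next
    case False
    then have e: "e < off (Suc (Q h))" using h by simp
    have P: "progress h t e Q par \<le> 3 * m" using progress_le h lt by simp
    show ?thesis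
    proof (cases "adj e = Q (par h)")
      case skip: True
      then show ?thesis
        using bfs_inv_skip[OF I e skip] T lt env' fin tb False h
        by (simp add: bfs_step_def scan_edge_def loop_inv_def Let_def d[symmetric])
    next
      case noskip: False
      show ?thesis
      proof (cases "pos (adj e) < t \<and> Q (pos (adj e)) = adj e")
        case True
        then have "bfs_found v h t (adj e) Q par pos"
          using I e noskip by (auto simp: bfs_found_def)
        then show ?thesis
          using T lt env' fin tb False h noskip True P
          by (simp add: bfs_step_def scan_edge_def loop_inv_def Let_def d[symmetric])
      next
        case new: False
        then show ?thesis
          using bfs_inv_push[OF I e new refl] T lt env' fin tb False h noskip
          by (auto simp: bfs_step_def scan_edge_def visit_def loop_inv_def Let_def d[symmetric])
      qed
    qed
  qed
qed

lemma wp_bfs: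
  assumes "env s" "regs s ''v'' < n" "0 < regs s ''lim''"
  shows "wp w bfs s (\<lambda>s'. time s' \<le> time s + 36 * regs s ''lim'' + 20 \<and>
    (if regs s' ''fin'' = 0
     then \<exists>h e. bfs_inv (regs s ''v'') h (regs s ''lim'') e (arrs s' ''Q'') (arrs s' ''par'') (arrs s' ''pos'')
     else bfs_found (regs s ''v'') (regs s' ''h'') (regs s' ''t'') (regs s' ''x'')
       (arrs s' ''Q'') (arrs s' ''par'') (arrs s' ''pos'') \<and> regs s' ''t'' \<le> regs s ''lim''))"
proof -
  define v m where d: "v = regs s ''v''" "m = regs s ''lim''"
  note init = bfs_inv_init[OF assms(2), folded d]
  note env' = assms(1)[unfolded env_def]
  have m: "0 < m" using assms d by simp
  have loop: "wp w (While (BAnd (Eq (Reg ''fin'') (Const 0)) (Less (Reg ''t'') (Reg ''lim''))) bfs_step) s0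
     (\<lambda>s'. time s' \<le> T + 36 * m + 13 \<and>
    (if regs s' ''fin'' = 0
     then \<exists>h e. bfs_inv v h m e (arrs s' ''Q'') (arrs s' ''par'') (arrs s' ''pos'')
     else bfs_found v (regs s' ''h'') (regs s' ''t'') (regs s' ''x'')
       (arrs s' ''Q'') (arrs s' ''par'') (arrs s' ''pos'') \<and> regs s' ''t'' \<le> m))"
    if s0: "loop_inv v m T s0" "env s0" "regs s0 ''lim'' = m" for s0 T
  \<comment> \<open>The variant is positive while the search runs, as \<open>progress\<close> is at
    most \<open>3 * m\<close>, and drops to 0 once \<open>fin\<close> is set. On exit with
    \<open>fin = 0\<close>, the failed test together with \<open>t \<le> m\<close> yields
    \<open>t = m\<close>.\<close>
  proof (rule wp_While_unchanged[where I = "loop_inv v m T" and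
        m = "\<lambda>s. if regs s ''fin'' = 0 then Suc (3 * m) -
           progress (regs s ''h'') (regs s ''t'') (regs s ''e'') (arrs s ''Q'') (arrs s ''par'') else 0"])
    show "loop_inv v m T s0" by (rule s0)
  next
    fix s' assume I: "loop_inv v m T s'"
      and u: "unchanged (written_regs bfs_step) (written_arrs bfs_step) s0 s'"
      and b: "bval w (BAnd (Eq (Reg ''fin'') (Const 0)) (Less (Reg ''t'') (Reg ''lim''))) s'"
    have "env s'" and l: "regs s' ''lim'' = m"
      using u s0 by (auto simp: unchanged_def env_def program_defs)
    then have "wp w bfs_step (tick s') (\<lambda>s''. loop_inv v m T s'' \<and>
    (regs s'' ''fin'' = 0 \<longrightarrow>
      progress (regs s' ''h'') (regs s' ''t'') (regs s' ''e'') (arrs s' ''Q'') (arrs s' ''par'') <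
      progress (regs s'' ''h'') (regs s'' ''t'') (regs s'' ''e'') (arrs s'' ''Q'') (arrs s'' ''par'')))"
      using b by (intro wp_bfs_step I) auto
    moreover have "progress (regs s' ''h'') (regs s' ''t'') (regs s' ''e'') (arrs s' ''Q'') (arrs s' ''par'') \<le> 3 * m"
      using I by (intro progress_le) (auto simp: loop_inv_def Let_def)
    ultimately show "wp w bfs_step (tick s') (\<lambda>s''. loop_inv v m T s'' \<and>
        (if regs s'' ''fin'' = 0 then Suc (3 * m) -
           progress (regs s'' ''h'') (regs s'' ''t'') (regs s'' ''e'') (arrs s'' ''Q'') (arrs s'' ''par'') else 0) <
        (if regs s' ''fin'' = 0 then Suc (3 * m) -
           progress (regs s' ''h'') (regs s' ''t'') (regs s' ''e'') (arrs s' ''Q'') (arrs s' ''par'') else 0))"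
      using b by (elim wp_mono) auto
  next
    fix s' assume I: "loop_inv v m T s'"
      and u: "unchanged (written_regs bfs_step) (written_arrs bfs_step) s0 s'"
      and b: "\<not> bval w (BAnd (Eq (Reg ''fin'') (Const 0)) (Less (Reg ''t'') (Reg ''lim''))) s'"
    have l: "regs s' ''lim'' = m"
      using u s0 by (auto simp: unchanged_def program_defs)
    have "progress (regs s' ''h'') (regs s' ''t'') (regs s' ''e'') (arrs s' ''Q'') (arrs s' ''par'') \<le> 3 * m"
      using I by (intro progress_le) (auto simp: loop_inv_def Let_def)
    then show "time (tick s') \<le> T + 36 * m + 13 \<and>
    (if regs (tick s') ''fin'' = 0
     then \<exists>h e. bfs_inv v h m e (arrs (tick s') ''Q'') (arrs (tick s') ''par'') (arrs (tick s') ''pos'')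
     else bfs_found v (regs (tick s') ''h'') (regs (tick s') ''t'') (regs (tick s') ''x'')
       (arrs (tick s') ''Q'') (arrs (tick s') ''par'') (arrs (tick s') ''pos'') \<and> regs (tick s') ''t'' \<le> m)"
      using I b l by (auto simp: loop_inv_def Let_def split: if_splits) blast
  qed
  show ?thesis
    unfolding bfs_def d[symmetric]
    apply (simp add: d[symmetric])
    apply (rule wp_mono, rule loop[where T = "time s + 7"])
     apply (use init m in \<open>simp_all add: loop_inv_def Let_def env' env_def d[symmetric]\<close>)
    done
qed

lemma climb_cases:
  assumes "\<forall>i<t. 0 < i \<longrightarrow> par i < i" "i < t" "j < t" "i \<noteq> j"
  shows "j < i \<Longrightarrow> climb par i j = i # climb par (par i) j \<and> par i < t"
    and "\<not> j < i \<Longrightarrow> climb par i j = climb par i (par j) @ [j] \<and> par j < t"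
  using assms by (subst climb.simps; fastforce)+

text \<open>The length of the path still to climb plus \<open>b\<close> is invariant. The pointers
  meet when that path has one node, whence \<open>Suc\<close>.\<close>

lemma wp_measure_cycle:
  assumes par: "par = arrs s ''par''" "\<forall>i<t. 0 < i \<longrightarrow> par i < i"
    and h: "h = regs s ''h''" "h < t" and p: "p = arrs s ''pos'' (regs s ''x'')" "p < t" and "t \<le> n"
  shows "wp w measure_cycle s (\<lambda>s'. Suc (regs s' ''b'') = length (climb par h p) \<and>
    time s' \<le> time s + 4 * length (climb par h p) + 5)"
proof -
  let ?L = "length (climb par h p)"
  have L: "?L \<le> t"
  proof -
    have "distinct (climb par h p)" "set (climb par h p) \<subseteq> {..max h p}"
      using climb_props[OF par(2) h(2) p(2)] by auto
    moreover have "{..max h p} \<subseteq> {..<t}" using h p by auto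
    ultimately show ?thesis
      by (metis card_lessThan card_mono distinct_card finite_lessThan order_trans)
  qed
  have loop: "wp w (While (BNot (Eq (Reg ''i'') (Reg ''j'')))
      (Seq (Assign ''b'' (Add (Reg ''b'') (Const 1)))
        (Cond (Less (Reg ''j'') (Reg ''i''))
          (Assign ''i'' (Load ''par'' (Reg ''i'')))
          (Assign ''j'' (Load ''par'' (Reg ''j'')))))) s0
     (\<lambda>s'. Suc (regs s' ''b'') = ?L \<and> time s' \<le> time s + 4 * ?L + 5)"
    if s0: "regs s0 ''i'' = h" "regs s0 ''j'' = p" "regs s0 ''b'' = 0" "time s0 = time s + 3"
      "arrs s0 ''par'' = par" for s0
  proof (rule wp_While[where m = "\<lambda>s. regs s ''i'' + regs s ''j''" and
      I = "\<lambda>s'. regs s' ''i'' < t \<and> regs s' ''j'' < t \<and> arrs s' ''par'' = par \<and>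
        regs s' ''b'' + length (climb par (regs s' ''i'') (regs s' ''j'')) = ?L \<and>
        time s' \<le> time s + 4 * regs s' ''b'' + 3"], goal_cases)
    case 1
    then show ?case using s0 h p by simp
  next
    case (2 s')
    note C = climb_cases[OF par(2), of "regs s' ''i''" "regs s' ''j''"]
    have pj: "par (regs s' ''j'') < regs s' ''j''" if "regs s' ''i'' < regs s' ''j''"
      using 2 par that by simp
    have pi: "par (regs s' ''i'') < regs s' ''i''" if "regs s' ''j'' < regs s' ''i''"
      using 2 par that by simp
    have "regs s' ''b'' \<le> n" using 2 L \<open>t \<le> n\<close> by simp
    then have tb: "take_bit w (Suc (regs s' ''b'')) = Suc (regs s' ''b'')"
      by (rule take_bit_Suc_le_n)
    show ?case
      using 2 C pi pj tb by (auto simp: not_less)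
  next
    case (3 s')
    then show ?case by (auto simp: climb.simps)
  qed
  show ?thesis
    unfolding measure_cycle_def
    apply (simp del: One_nat_def)
    apply (rule loop)
        apply (use par h p in simp_all)
    done
qed

text \<open>The path still to climb is flanked by nodes already written: \<open>ys\<close> in the
  cells below \<open>a\<close>, \<open>zs\<close> in the cells above \<open>b\<close>. When the
  pointers meet, \<open>a = b\<close> is the one free cell and receives the common ancestor.\<close>

lemma wp_write_cycle:
  assumes par: "par = arrs s ''par''" "\<forall>i<t. 0 < i \<longrightarrow> par i < i"
    and h: "h = regs s ''h''" "h < t" and p: "p = arrs s ''pos'' (regs s ''x'')" "p < t" and "t \<le> n"
    and b: "Suc (regs s ''b'') = length (climb par h p)"
  shows "wp w write_cycle s (\<lambda>s'. regs s' ''len'' = length (climb par h p) \<and>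
    map (arrs s' ''out'') [0..<regs s' ''len''] = map (arrs s ''Q'') (climb par h p) \<and>
    time s' \<le> time s + 5 * length (climb par h p) + 7)"
proof -
  define c where "c = climb par h p"
  let ?Q = "arrs s ''Q''"
  have L: "length c \<le> t"
  proof -
    have "distinct c" "set c \<subseteq> {..max h p}"
      using climb_props[OF par(2) h(2) p(2)] by (auto simp: c_def)
    moreover have "{..max h p} \<subseteq> {..<t}" using h p by auto
    ultimately show ?thesis
      by (metis card_lessThan card_mono distinct_card finite_lessThan order_trans)
  qed
  have tb: "take_bit w (Suc x) = Suc x" if "x \<le> n" for x
    using that by (rule take_bit_Suc_le_n)
  have loop: "wp w (While (BNot (Eq (Reg ''i'') (Reg ''j'')))
      (Cond (Less (Reg ''j'') (Reg ''i''))
        (Seq (Store ''out'' (Reg ''a'') (Load ''Q'' (Reg ''i'')))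
        (Seq (Assign ''a'' (Add (Reg ''a'') (Const 1)))
          (Assign ''i'' (Load ''par'' (Reg ''i'')))))
        (Seq (Store ''out'' (Reg ''b'') (Load ''Q'' (Reg ''j'')))
        (Seq (Assign ''b'' (Sub (Reg ''b'') (Const 1)))
          (Assign ''j'' (Load ''par'' (Reg ''j''))))))) s0
     (\<lambda>s'. wp w (Store ''out'' (Reg ''a'') (Load ''Q'' (Reg ''i''))) s' (\<lambda>s'. regs s' ''len'' = length c \<and>
       map (arrs s' ''out'') [0..<regs s' ''len''] = map ?Q c \<and>
       time s' \<le> time s + 5 * length c + 7))"
    if s0: "regs s0 ''i'' = h" "regs s0 ''j'' = p" "Suc (regs s0 ''b'') = length c"
      "regs s0 ''len'' = length c" "regs s0 ''a'' = 0" "time s0 = time s + 4"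
      "arrs s0 ''par'' = par" "arrs s0 ''Q'' = ?Q" for s0
  proof (rule wp_While_unchanged[where m = "\<lambda>s. regs s ''i'' + regs s ''j''" and
      I = "\<lambda>s'. regs s' ''i'' < t \<and> regs s' ''j'' < t \<and>
        (\<exists>ys zs. c = ys @ climb par (regs s' ''i'') (regs s' ''j'') @ zs \<and>
          length ys = regs s' ''a'' \<and> length c = Suc (regs s' ''b'') + length zs \<and>
          time s' \<le> time s + 5 * (length ys + length zs) + 4) \<and>
        (\<forall>k<length c. k < regs s' ''a'' \<or> regs s' ''b'' < k \<longrightarrow> arrs s' ''out'' k = ?Q (c ! k))"],
      goal_cases)
    case 1
    then show ?case using s0 h p by (auto simp: c_def intro!: exI[of _ "[]"])
  next
    case (2 s')
    define i j a b where d: "i = regs s' ''i''" "j = regs s' ''j''" "a = regs s' ''a''" "b = regs s' ''b''"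
    from 2(1) obtain ys zs where I: "i < t" "j < t" "c = ys @ climb par i j @ zs" "length ys = a"
      "length c = Suc b + length zs" "time s' \<le> time s + 5 * (length ys + length zs) + 4"
      "\<forall>k<length c. k < a \<or> b < k \<longrightarrow> arrs s' ''out'' k = ?Q (c ! k)"
      by (auto simp: d)
    have ij: "i \<noteq> j" using 2(3) by (simp add: d)
    note C = climb_cases[OF par(2) I(1,2) ij]
    have u: "arrs s' ''par'' = par" "arrs s' ''Q'' = ?Q"
      using 2(2) s0 by (auto simp: unchanged_def)
    have "a \<le> n" using I L \<open>t \<le> n\<close> by auto
    show ?case
    proof (cases "j < i")
      case True
      then have c: "c = (ys @ [i]) @ climb par (par i) j @ zs" and pi: "par i < i" "par i < t"
        using C(1) I par by auto
      then have ca: "c ! a = i" using I(4) by (simp add: nth_append)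
      have "\<exists>ys zs. c = ys @ climb par (par i) j @ zs \<and>
          length ys = Suc a \<and> length c = Suc b + length zs \<and>
          time s' + 5 \<le> time s + 5 * (length ys + length zs) + 4"
        using c I by (intro exI[of _ "ys @ [i]"] exI[of _ zs]) simp
      then show ?thesis
        using True I(1,2,7) pi u tb[OF \<open>a \<le> n\<close>] ca
        by (simp add: d[symmetric] less_Suc_eq)
    next
      case False
      then have c: "c = ys @ climb par i (par j) @ ([j] @ zs)" and pj: "par j < j" "par j < t"
        using C(2) I par ij by auto
      then have lb: "length (ys @ climb par i (par j)) = b"
        using I(5) by simp
      have cb: "c ! b = j" unfolding c lb[symmetric] by (simp add: nth_append)
      \<comment> \<open>Some node is still to be written to the left of \<open>j\<close>, so
        \<open>b\<close> is positive and the truncated subtraction is exact.\<close>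
      have "climb par i (par j) \<noteq> []" using climb_ne[OF par(2) I(1) pj(2)] .
      then have b0: "0 < b" using lb by auto
      have "\<exists>ys zs. c = ys @ climb par i (par j) @ zs \<and>
          length ys = a \<and> length c = b + length zs \<and>
          time s' + 5 \<le> time s + 5 * (length ys + length zs) + 4"
        using c I by (intro exI[of _ "ys"] exI[of _ "[j] @ zs"]) simp
      moreover have "k = b \<or> b < k" if "b - Suc 0 < k" for k using that b0 by linarith
      ultimately show ?thesis
        using False I(1,2,7) pj u cb b0
        by (simp add: d[symmetric])
    qed
  next
    case (3 s')
    then have ij: "regs s' ''i'' = regs s' ''j''" by simp
    with 3 obtain ys zs where c: "c = ys @ [regs s' ''i''] @ zs" "length ys = regs s' ''a''"
       "length c = Suc (regs s' ''b'') + length zs" "time s' \<le> time s + 5 * (length ys + length zs) + 4"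
       and o: "\<forall>k<length c. k < regs s' ''a'' \<or> regs s' ''b'' < k \<longrightarrow> arrs s' ''out'' k = ?Q (c ! k)"
      by (auto simp: climb.simps)
    have ab: "regs s' ''a'' = regs s' ''b''" using c by simp
    have u: "arrs s' ''Q'' = ?Q" "regs s' ''len'' = length c"
      using 3(2) s0 by (auto simp: unchanged_def)
    have "c ! regs s' ''a'' = regs s' ''i''" using c(1,2) by (simp add: nth_append)
    then have "\<forall>k<length c. ((arrs s' ''out'')(regs s' ''a'' := ?Q (regs s' ''i''))) k = ?Q (c ! k)"
      using o ab by (simp add: not_less) (metis nat_neq_iff)
    then have "map ((arrs s' ''out'')(regs s' ''a'' := ?Q (regs s' ''i''))) [0..<length c] = map ?Q c"
      by (intro nth_equalityI) (simp_all del: fun_upd_apply)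
    moreover have "length ys + length zs \<le> length c" using c(1) by simp
    ultimately show ?case
      using u c(4) by simp
  qed
  have lb: "length c = Suc (regs s ''b'')" "regs s ''b'' \<le> n"
    using L \<open>t \<le> n\<close> b by (auto simp: c_def)
  show ?thesis
    unfolding write_cycle_def c_def[symmetric]
    apply (simp del: One_nat_def wp_Store)
    apply (rule loop)
           apply (use par h p lb tb in simp_all)
    done
qed

text \<open>\<open>Q\<close> is injective on queue positions, so the tree path maps to a path in
  \<open>G\<close>; the non-tree edge between \<open>x\<close> and the head closes it.\<close>

lemma climb_ucycle:
  assumes "bfs_found v h t x Q par pos"
  shows "ucycle G (let c = map Q (climb par h (pos x)) in vwalk_arcs (c @ [hd c]))"
proof -
  from assms obtain e where inv: "bfs_inv v h t e Q par pos" and e: "e < off (Suc (Q h))"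
      and x: "adj e = x" "pos x < t" "Q (pos x) = x" "x \<noteq> Q (par h)"
    by (auto simp: bfs_found_def)
  have h: "h < t" "Q h < n" "off (Q h) \<le> e" and q: "queue_inv v t Q par pos"
    using inv by (auto simp: bfs_inv_def queue_inv_def)
  note qD = queue_invD[OF q]
  have par: "\<forall>i<t. 0 < i \<longrightarrow> par i < i" using qD(6) by blast
  note N = bfs_inv_not_tree_adjacent[OF inv e x]
  let ?c = "climb par h (pos x)"
  note P = climb_props[OF par h(1) x(2)] and ne = climb_ne[OF par h(1) x(2)]
  have edge: "(Q h, x) \<in> parcs G" using adj_E h e x by blast
  have sub: "a < t" if "a \<in> set ?c" for a using P h x(2) that by (auto simp: subset_iff)
  have inj: "inj_on Q (set ?c)" using qD(5) sub by (metis inj_onI)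
  have arcs: "(Q a, Q b) \<in> parcs G" if "(a, b) \<in> set (vwalk_arcs ?c)" for a b
  proof -
    have "a \<in> set ?c" "b \<in> set ?c"
      using that in_set_vwalk_arcsE by (metis)+
    then have "a < t" "b < t" using sub by auto
    moreover have "tree_adjacent par a b" using P that by auto
    ultimately show ?thesis using qD(7) sym by (auto simp: tree_adjacent_def)
  qed
  have "ucycle G (vwalk_arcs (map Q ?c @ [hd (map Q ?c)]))"
  proof (rule ucycle_vwalk_arcs[OF pair_graph])
    show "distinct (map Q ?c)" using P inj by (simp add: distinct_map)
    show "3 \<le> length (map Q ?c)" using length_climb_ge_3[OF par h(1) x(2) N] by simp
    show "set (map Q ?c) \<subseteq> pverts G" using sub qD(4) verts by auto
    show "set (vwalk_arcs (map Q ?c)) \<subseteq> parcs G" using arcs by (auto simp: vwalk_arcs_map)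
    show "(last (map Q ?c), hd (map Q ?c)) \<in> parcs G"
      using P ne x edge sym by (simp add: last_map hd_map)
  qed
  then show ?thesis by (simp add: Let_def)
qed

text \<open>The length \<open>n + 1\<close> stands for \<open>no cycle found yet\<close>.\<close>

definition sound :: "state \<Rightarrow> bool" where
  "sound s \<longleftrightarrow> regs s ''len'' = Suc n \<or> ucycle G (output_walk s)"

text \<open>The program does not know \<open>d\<close>, so the last clause covers all
  \<open>d\<close> at once: either the search fills its quota and its vertices form a large set
  close to \<open>Z\<close>, or a short cycle is stored. The clause before it makes repetition
  harmless.\<close>

lemma wp_search:
  assumes "env s" "regs s ''v'' < n" "0 < regs s ''lim''" "sound s"
  shows "wp w search s (\<lambda>s'. time s' \<le> time s + 50 * regs s ''lim'' + 50 \<and> sound s' \<and>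
    (ucycle G (output_walk s) \<longrightarrow> ucycle G (output_walk s') \<and> regs s' ''len'' \<le> regs s ''len'') \<and>
    (\<forall>d. mutually_close (parcs G) d {regs s ''v''} Z \<longrightarrow>
      (\<exists>S. S \<subseteq> {..<n} \<and> card S = regs s ''lim'' \<and> mutually_close (parcs G) (2 * d + 1) S Z) \<or>
      (ucycle G (output_walk s') \<and> regs s' ''len'' \<le> 2 * (d + 1))))"
proof -
  define v m where d: "v = regs s ''v''" "m = regs s ''lim''"
  let ?Q = "\<lambda>s'. time s' \<le> time s + 50 * m + 50 \<and> sound s' \<and>
    (ucycle G (output_walk s) \<longrightarrow> ucycle G (output_walk s') \<and> regs s' ''len'' \<le> regs s ''len'') \<and>
    (\<forall>d. mutually_close (parcs G) d {v} Z \<longrightarrow>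
      (\<exists>S. S \<subseteq> {..<n} \<and> card S = m \<and> mutually_close (parcs G) (2 * d + 1) S Z) \<or>
      (ucycle G (output_walk s') \<and> regs s' ''len'' \<le> 2 * (d + 1)))"
  show ?thesis
    unfolding search_def d[symmetric] wp_Seq
  proof (rule wp_unchanged[OF wp_bfs[OF assms(1-3)]], goal_cases)
    case (1 s1)
    have u: "regs s1 ''len'' = regs s ''len''" "output_walk s1 = output_walk s"
      using 1(2) by (auto simp: unchanged_def program_defs output_walk_def)
    show ?case
    proof (cases "regs s1 ''fin'' = 0")
      case True
      with 1 obtain h e where inv: "bfs_inv v h m e (arrs s1 ''Q'') (arrs s1 ''par'') (arrs s1 ''pos'')"
        and T: "time s1 \<le> time s + 36 * m + 20"
        by (auto simp: d)
      have "sound (tick (tick s1))" "output_walk (tick (tick s1)) = output_walk s"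
        using assms(4) u by (auto simp: sound_def output_walk_def)
      then show ?thesis using bfs_ball[OF inv Z(2,3)] T True u by simp
    next
      case False
      define h t x Q par pos where d': "h = regs s1 ''h''" "t = regs s1 ''t''" "x = regs s1 ''x''"
        "Q = arrs s1 ''Q''" "par = arrs s1 ''par''" "pos = arrs s1 ''pos''"
      from 1 False have F: "bfs_found v h t x Q par pos" and T: "time s1 \<le> time s + 36 * m + 20"
        and tm: "t \<le> m" by (auto simp: d d')
      from F obtain e where inv: "bfs_inv v h t e Q par pos"
          and x: "pos x < t" "Q (pos x) = x"
        by (auto simp: bfs_found_def)
      have h: "h < t" and q: "queue_inv v t Q par pos"
        using inv by (auto simp: bfs_inv_def queue_inv_def)
      have par: "\<forall>i<t. 0 < i \<longrightarrow> par i < i" using queue_invD(6)[OF q] by blast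
      note tn = queue_inv_le_n[OF q]
      define c where "c = climb par h (pos x)"
      note P = climb_props[OF par h x(1), folded c_def]
      have lc: "length c \<le> t"
      proof -
        have "{..max h (pos x)} \<subseteq> {..<t}" using h x by auto
        then show ?thesis using P
          by (metis card_lessThan card_mono distinct_card finite_lessThan order_trans)
      qed
      \<comment> \<open>The head has depth at most \<open>d\<close> and the other endpoint at most
        \<open>d + 1\<close>; a path has one more node than arcs.\<close>
      have short: "length c \<le> 2 * (d + 1)" if "mutually_close (parcs G) d {v} Z" for d
        using depth_le[OF inv Z(2,3) that] queue_depth_le[OF inv _ x(1), of d] P by simp
      have cyc: "ucycle G (vwalk_arcs (map Q c @ [hd (map Q c)]))"
        using climb_ucycle[OF F] by (simp add: c_def Let_def)
      have "wp w measure_cycle (tick s1) (\<lambda>s'. Suc (regs s' ''b'') = length c \<and>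
          time s' \<le> time (tick s1) + 4 * length c + 5)"
        unfolding c_def by (rule wp_measure_cycle[OF _ par _ h _ x(1) tn]) (simp_all add: d')
      then have "wp w measure_cycle (tick s1) (\<lambda>s2. wp w
         (Cond (Less (Add (Reg ''b'') (Const 1)) (Reg ''len'')) write_cycle Skip) s2 ?Q)"
      proof (rule wp_unchanged, goal_cases)
        case (1 s2)
        then have b: "Suc (regs s2 ''b'') = length c" and T2: "time s2 \<le> time s + 40 * m + 26"
          using T lc tm by simp_all
        have u2: "regs s2 ''len'' = regs s ''len''" "output_walk s2 = output_walk s"
          "regs s2 ''h'' = h" "regs s2 ''x'' = x"
          "arrs s2 ''Q'' = Q" "arrs s2 ''par'' = par" "arrs s2 ''pos'' = pos"
          using 1(2) u by (auto simp: unchanged_def program_defs output_walk_def d')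
        have tb: "take_bit w (Suc (regs s2 ''b'')) = Suc (regs s2 ''b'')"
          using lc tn b by (intro take_bit_Suc_le_n) simp
        show ?case
        proof (cases "length c < regs s ''len''")
          case True
          have "wp w write_cycle (tick s2) (\<lambda>s'. regs s' ''len'' = length c \<and>
            map (arrs s' ''out'') [0..<regs s' ''len''] = map Q c \<and>
            time s' \<le> time (tick s2) + 5 * length c + 7)"
            using wp_write_cycle[OF _ par _ h _ x(1) tn, of "tick s2"] b u2
            by (simp add: c_def)
          then have "wp w write_cycle (tick s2) ?Q"
          proof (rule wp_mono, goal_cases)
            case (1 s3)
            then have "output_walk s3 = vwalk_arcs (map Q c @ [hd (map Q c)])"
              unfolding output_walk_def Let_def by metis
            then show ?case using 1 cyc short True T2 lc tm by (auto simp: sound_def)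
          qed
          then show ?thesis using True u2 tb b by simp
        next
          case False
          \<comment> \<open>A cycle found has at most \<open>n\<close> vertices and would beat the
            sentinel \<open>n + 1\<close>. Not being shorter means that a genuine cycle is stored
            already.\<close>
          then have "regs s ''len'' \<noteq> Suc n" using lc tn by simp
          then have "ucycle G (output_walk s)" using assms(4) by (simp add: sound_def)
          moreover have "output_walk (tick (tick s2)) = output_walk s"
            using u2 by (simp add: output_walk_def)
          moreover have "regs s ''len'' \<le> 2 * (d + 1)" if "mutually_close (parcs G) d {v} Z" for d
            using short[OF that] False by linarith
          ultimately show ?thesis using False u2 tb b T2 by (auto simp: sound_def)
        qed
      qed
      then show ?thesis using False by simp
    qed
  qed
qed

end

section \<open>Sampling\<close>

lemma pr_Seq_assoc: "pr w (Seq (Seq a b) c) s Q = pr w (Seq a (Seq b c)) s Q"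
  by (simp add: pr_def exec.simps(5)[abs_def])

lemma pr_Assign_Seq:
  "pr w (Seq (Assign x e) c) s Q = pr w c (tick (set_reg x (aval w e s) s)) Q"
  by (simp add: pr_def)

lemma pr_conj_wp:
  assumes "wp w c s R"
  shows "pr w c s (\<lambda>s'. Q s' \<and> R s') = pr w c s Q"
  unfolding pr_def using assms
  by (intro measure_spmf.finite_measure_eq_AE) (auto simp: wp_def)

text \<open>Finds the least \<open>L\<close> with \<open>2 ^ L \<ge> n\<close>, relying on
  \<open>L\<close> being 0 initially.\<close>

definition log_size :: com where
  "log_size =
    Seq (Assign ''q'' (Const 1))
    (While (Less (Reg ''q'') (Reg ''n''))
      (Seq (Assign ''q'' (Add (Reg ''q'') (Reg ''q'')))
        (Assign ''L'' (Add (Reg ''L'') (Const 1)))))"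

definition try_base :: com where
  "try_base =
    Seq (Assign ''r'' (Add (Reg ''r'') (Const 1)))
    (Seq (Assign ''p'' (Const 1))
    (Seq (Assign ''c'' (Const 0))
    (While (BAnd (Less (Reg ''c'') (Reg ''k'')) (BNot (Less (Reg ''n'') (Reg ''p''))))
      (Seq (Assign ''p'' (Mul (Reg ''p'') (Reg ''r'')))
        (Assign ''c'' (Add (Reg ''c'') (Const 1)))))))"

text \<open>
  Computes the least \<open>r\<close> with \<open>r ^ k > n\<close>, as \<open>p\<close> is initially 0 and \<open>1 ^ k \<le> n\<close>.
  Powers are cut off as soon as they exceed \<open>n\<close>, hence there is no overflow.
\<close>

definition root_base :: com where
  "root_base =
    Seq (Assign ''r'' (Const 1))
    (While (BNot (Less (Reg ''n'') (Reg ''p''))) try_base)"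

definition sample :: com where
  "sample =
    Seq (Assign ''N'' (Sub (Reg ''N'') (Const 1)))
    (Seq (Random ''v'' (Reg ''n'')) search)"

definition samples :: com where
  "samples = While (Less (Const 0) (Reg ''N'')) sample"

text \<open>\<open>s\<close> is the current power of \<open>r\<close>. A set of \<open>s\<close>
  vertices is hit with probability \<open>s / n\<close> per draw, so about \<open>n / s\<close>
  draws hit it with constant probability; the factor \<open>L\<close> amplifies this.\<close>

definition level :: com where
  "level =
    Seq (Assign ''N'' (Mul (Add (Div (Reg ''n'') (Reg ''s'')) (Const 1)) (Reg ''L'')))
    (Seq (Assign ''lim'' (Mul (Reg ''s'') (Reg ''r'')))
    (Seq samples
    (Assign ''s'' (Reg ''lim''))))"

definition levels :: com where
  "levels = While (BNot (Less (Reg ''n'') (Reg ''s''))) level"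

definition setup_regs :: com where
  "setup_regs =
    Seq log_size
    (Seq root_base
    (Seq (Assign ''s'' (Const 1))
    (Assign ''len'' (Add (Reg ''n'') (Const 1)))))"

definition girth_program :: com where
  "girth_program = Seq setup_regs levels"

lemmas main_defs = log_size_def try_base_def root_base_def sample_def samples_def level_def
  levels_def setup_regs_def

context girth_input
begin

definition good :: "nat \<Rightarrow> state \<Rightarrow> bool" where
  "good B s \<longleftrightarrow> ucycle G (output_walk s) \<and> regs s ''len'' \<le> B"

lemma output_walk_cong:
  "arrs s' ''out'' = arrs s ''out'' \<Longrightarrow> regs s' ''len'' = regs s ''len'' \<Longrightarrow> output_walk s' = output_walk s"
  by (simp add: output_walk_def)

lemma wp_samples:
  assumes "env s" "sound s" "0 < regs s ''lim''"
  shows "wp w samples s (\<lambda>s'. time s' \<le> time s + 110 * regs s ''N'' * regs s ''lim'' + 1 \<and>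
    sound s' \<and> (good B s \<longrightarrow> good B s'))"
  unfolding samples_def
proof (rule wp_While_unchanged[where m = "\<lambda>s. regs s ''N''" and
    I = "\<lambda>s'. sound s' \<and> (good B s \<longrightarrow> good B s') \<and> regs s' ''N'' \<le> regs s ''N'' \<and>
      time s' + 110 * regs s' ''N'' * regs s ''lim'' \<le> time s + 110 * regs s ''N'' * regs s ''lim''"],
    goal_cases)
  case 1
  then show ?case using assms by simp
next
  case (2 s')
  let ?m = "regs s ''lim''"
  from 2(2) assms have u: "env s'" "regs s' ''lim'' = ?m"
    by (auto simp: unchanged_def env_def program_defs sample_def)
  then have n: "regs s' ''n'' = n" by (simp add: env_def)
  obtain K where K: "regs s' ''N'' = Suc K" using 2(3) by (cases "regs s' ''N''") auto
  have step: "wp w search s'' (\<lambda>s''. (sound s'' \<and> (good B s \<longrightarrow> good B s'') \<and>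
       regs s'' ''N'' \<le> regs s ''N'' \<and>
       time s'' + 110 * regs s'' ''N'' * ?m \<le> time s + 110 * regs s ''N'' * ?m) \<and>
       regs s'' ''N'' < regs s' ''N'')"
    if v: "v < n" and s'': "s'' = tick (set_reg ''v'' v (tick (set_reg ''N'' K (tick s'))))" for v s''
  proof -
    have o: "output_walk s'' = output_walk s'" "regs s'' ''len'' = regs s' ''len''"
      by (auto simp: s'' intro: output_walk_cong)
    have "env s''" "regs s'' ''v'' < n" "0 < regs s'' ''lim''" "sound s''"
      using u 2 assms v o by (auto simp: env_def s'' sound_def)
    from wp_search[OF this] show ?thesis
    proof (rule wp_unchanged, goal_cases)
      case (1 s3)
      have l: "regs s'' ''lim'' = ?m" using u s'' by simp
      have N: "regs s3 ''N'' = K"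
        using 1(2) s'' by (auto simp: unchanged_def program_defs)
      have t: "time s3 \<le> time s' + 50 * ?m + 53" using 1(1) l s'' by simp
      \<comment> \<open>One sample costs at most \<open>50 * ?m + 53\<close>, which is below
        \<open>110 * ?m\<close> because \<open>?m \<ge> 1\<close>.\<close>
      have "time s3 + 110 * K * ?m \<le> time s' + 110 * Suc K * ?m"
        using t assms(3) by (simp add: algebra_simps)
      then show ?case using 1 2 K N o by (auto simp: good_def)
    qed
  qed
  have N: "aval w (Sub (Reg ''N'') (Const 1)) (tick s') = K" using K by simp
  show ?case
    unfolding sample_def wp_Seq wp_Assign wp_Random N
    by (intro conjI allI impI step[OF _ refl]) (use n n_ge in simp_all)
next
  case (3 s')
  have "output_walk (tick s') = output_walk s'" by (auto intro: output_walk_cong)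
  then show ?case using 3 by (auto simp: sound_def good_def)
qed

text \<open>A draw in \<open>S\<close> succeeds, because \<open>no\<close> excludes a search that
  fills its quota, and later samples preserve the success. So failure requires that every draw
  misses \<open>S\<close>.\<close>

lemma pr_samples:
  assumes S: "S \<subseteq> {..<n}" "mutually_close (parcs G) d S Z" "2 * (d + 1) \<le> B"
    and no: "\<nexists>S. S \<subseteq> {..<n} \<and> card S = m \<and> mutually_close (parcs G) (2 * d + 1) S Z"
    and m: "0 < m"
  shows "env s \<Longrightarrow> sound s \<Longrightarrow> regs s ''lim'' = m \<Longrightarrow>
    1 - (1 - card S / n) ^ regs s ''N'' \<le> pr w samples s (good B)"
proof (induction "regs s ''N''" arbitrary: s)
  case 0
  then show ?case by (simp add: pr_nonneg)
next
  case (Suc K)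
  let ?y = "1 - card S / n"
  let ?s = "\<lambda>v. tick (set_reg ''v'' v (tick (set_reg ''N'' K (tick s))))"
  have n: "regs s ''n'' = n" using Suc by (simp add: env_def)
  have N: "regs s ''N'' = Suc K" using Suc by simp
  have hyps: "env (?s v)" "sound (?s v)" "regs (?s v) ''lim'' = m" for v
    using Suc by (auto simp: env_def sound_def output_walk_def)
  have ge: "(if v \<in> S then 1 else 1 - ?y ^ K) \<le> pr w (Seq search samples) (?s v) (good B)"
    if v: "v < n" for v
  proof -
    have *: "wp w search (?s v) (\<lambda>s'. (sound s' \<and> (v \<in> S \<longrightarrow> good B s')) \<and>
        env s' \<and> regs s' ''lim'' = m \<and> regs s' ''N'' = K)"
    proof (rule wp_unchanged[OF wp_search], goal_cases)
      case (5 s')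
      have "mutually_close (parcs G) d {v} Z" if "v \<in> S"
        using S(2) that by (auto simp: mutually_close_def)
      then have "good B s'" if "v \<in> S"
        using 5(1) that no hyps(3)[of v] S(3) unfolding good_def by fastforce
      moreover have "env s' \<and> regs s' ''lim'' = m \<and> regs s' ''N'' = K"
        using 5(2) hyps(1,3)[of v] by (simp add: unchanged_def program_defs env_def)
      ultimately show ?case using 5(1) by blast
    qed (use hyps[of v] m v in auto)
    show ?thesis
    proof (cases "v \<in> S")
      case True
      have "wp w (Seq search samples) (?s v) (good B)"
        unfolding wp_Seq
        by (rule wp_mono[OF *], rule wp_mono[OF wp_samples[where B = B]]) (use True m in auto)
      then show ?thesis using True pr_eq_1 by simp
    next
      case False
      have "1 - ?y ^ K \<le> pr w (Seq search samples) (?s v) (good B)"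
        by (rule pr_Seq_ge[OF *]) (use Suc.hyps(1) in auto)
      then show ?thesis using False by simp
    qed
  qed
  \<comment> \<open>Averaging over the first draw: \<open>card S\<close> of the \<open>n\<close>
    values contribute 1, the others the bound for the remaining \<open>K\<close> samples.\<close>
  have "1 - ?y ^ Suc K = (card S + (real n - card S) * (1 - ?y ^ K)) / n"
    using n_ge by (simp add: field_simps)
  also have "card S + (real n - card S) * (1 - ?y ^ K) = (\<Sum>v<n. if v \<in> S then 1 else 1 - ?y ^ K)"
  proof -
    have "{..<n} \<inter> S = S" using S by auto
    moreover have "real (card ({..<n} - S)) = real n - card S"
      using S by (simp add: card_Diff_subset finite_subset of_nat_diff card_mono[of "{..<n}" S, simplified])
    moreover have "{..<n} \<inter> - S = {..<n} - S" by auto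
    ultimately show ?thesis by (simp add: sum.If_cases)
  qed
  also have "\<dots> / n \<le> (\<Sum>v<n. pr w (Seq search samples) (?s v) (good B)) / n"
    using ge by (intro divide_right_mono sum_mono) auto
  also have "\<dots> = pr w samples s (good B)"
    unfolding samples_def
    by (subst pr_While_unfold)
      (simp add: N n samples_def[symmetric] sample_def pr_Seq_assoc pr_Assign_Seq pr_Random_Seq)
  finally show ?case by (simp add: N)
qed

end

text \<open>\<open>n div a + 1\<close> exceeds \<open>n / a\<close>, so that many draws all miss
  with probability at most \<open>exp (-1) \<le> 1 / 2\<close>; \<open>L\<close> such blocks bring
  this down to \<open>1 / 2 ^ L \<le> 1 / n\<close>.\<close>

lemma miss_probability_le:
  fixes a n L :: nat
  assumes "0 < n" "a \<le> n" "0 < a" "n \<le> 2 ^ L"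
  shows "(1 - real a / real n) ^ ((n div a + 1) * L) \<le> 1 / n"
proof -
  let ?x = "real a / real n"
  have x: "0 \<le> ?x" "?x \<le> 1" using assms by auto
  have "n < (n div a + 1) * a"
    using assms by (metis Suc_eq_plus1 dividend_less_div_times mult.commute mult_Suc)
  then have "real n \<le> real ((n div a + 1) * a)" by (intro of_nat_mono) simp
  then have "real n \<le> real (n div a + 1) * real a" by (simp only: of_nat_mult)
  then have ge: "1 \<le> real (n div a + 1) * ?x"
    using assms by (simp add: field_simps)
  have "(1 - ?x) ^ (n div a + 1) \<le> exp (- ?x) ^ (n div a + 1)"
    using x exp_ge_add_one_self[of "- ?x"] by (intro power_mono) auto
  also have "\<dots> = exp (- (real (n div a + 1) * ?x))"
    by (subst exp_of_nat_mult[symmetric]) simp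
  also have "\<dots> \<le> exp (-1)" using ge by simp
  also have "\<dots> \<le> 1 / 2"
    using exp_ge_add_one_self[of 1] by (simp add: exp_minus field_simps)
  finally have "((1 - ?x) ^ (n div a + 1)) ^ L \<le> (1 / 2) ^ L"
    using x by (intro power_mono) auto
  also have "\<dots> = 1 / real (2 ^ L)" by (simp add: power_one_over)
  also have "\<dots> \<le> 1 / n" using assms by (intro divide_left_mono of_nat_mono) auto
  finally show ?thesis by (simp only: power_mult)
qed

context girth_input
begin

definition level_env :: "nat \<Rightarrow> nat \<Rightarrow> state \<Rightarrow> bool" where
  "level_env r L s \<longleftrightarrow> env s \<and> sound s \<and> regs s ''r'' = r \<and> regs s ''L'' = L"

lemma level_arith:
  assumes "regs s ''s'' = a" "0 < a" "a \<le> n" "level_env r L s" "r \<le> n" "L \<le> n"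
  shows "aval w (Mul (Add (Div (Reg ''n'') (Reg ''s'')) (Const 1)) (Reg ''L'')) s = (n div a + 1) * L"
    and "regs s' ''s'' = regs s ''s'' \<Longrightarrow> regs s' ''r'' = regs s ''r'' \<Longrightarrow>
      aval w (Mul (Reg ''s'') (Reg ''r'')) s' = a * r"
proof -
  have d: "n div a \<le> n" by simp
  have "(n div a + 1) * L \<le> (n + 1) * n" using d assms by (intro mult_mono) auto
  then have 1: "take_bit w ((n div a + 1) * L) = (n div a + 1) * L" by (intro take_bit_le) simp
  have "a * r \<le> n * n" using assms by (intro mult_mono) auto
  then have 2: "take_bit w (a * r) = a * r" by (intro take_bit_le) simp
  show "aval w (Mul (Add (Div (Reg ''n'') (Reg ''s'')) (Const 1)) (Reg ''L'')) s = (n div a + 1) * L"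
    using 1 assms take_bit_Suc_le_n[OF d] by (simp add: level_env_def env_def)
  show "regs s' ''s'' = regs s ''s'' \<Longrightarrow> regs s' ''r'' = regs s ''r'' \<Longrightarrow>
      aval w (Mul (Reg ''s'') (Reg ''r'')) s' = a * r"
    using 2 assms by (simp add: level_env_def)
qed

text \<open>The number of samples times the search limit loses its dependence on \<open>a\<close>,
  since \<open>(n div a + 1) * a \<le> 2 * n\<close>. Hence all levels have the same cost
  bound.\<close>

lemma wp_level:
  assumes a: "regs s ''s'' = a" "0 < a" "a \<le> n" and e: "level_env r L s"
    and rL: "0 < r" "r \<le> n" "0 < L" "L \<le> n"
  shows "wp w level s (\<lambda>s'. level_env r L s' \<and> regs s' ''s'' = a * r \<and>
    (good B s \<longrightarrow> good B s') \<and> time s' \<le> time s + 230 * (n * L * r))"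
proof -
  define s1 where "s1 = tick (set_reg ''N'' ((n div a + 1) * L) s)"
  define s2 where "s2 = tick (set_reg ''lim'' (a * r) s1)"
  note A = level_arith[OF a e rL(2,4)]
  have l: "regs s2 ''lim'' = a * r" "regs s2 ''N'' = (n div a + 1) * L" "time s2 = time s + 2"
    "regs s2 ''r'' = r" "regs s2 ''L'' = L" "env s2" "sound s2" "good B s2 = good B s"
    using e by (auto simp: s1_def s2_def level_env_def env_def sound_def good_def output_walk_def)
  have pos: "0 < regs s2 ''lim''" using l a rL by simp
  have "110 * ((n div a + 1) * L) * (a * r) = 110 * ((n div a) * a + a) * (L * r)"
    by (simp add: algebra_simps)
  also have "\<dots> \<le> 110 * (n + n) * (L * r)"
    using a by (intro mult_mono add_mono) auto
  finally have T: "110 * ((n div a + 1) * L) * (a * r) \<le> 220 * (n * L * r)"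
    by (simp add: algebra_simps)
  have "1 \<le> n * L * r" using rL a by (simp add: Suc_le_eq)
  with T have T: "110 * ((n div a + 1) * L) * (a * r) + 4 \<le> 230 * (n * L * r)" by linarith
  have "wp w samples s2 (\<lambda>s'. wp w (Assign ''s'' (Reg ''lim'')) s' (\<lambda>s'. level_env r L s' \<and>
      regs s' ''s'' = a * r \<and> (good B s \<longrightarrow> good B s') \<and> time s' \<le> time s + 230 * (n * L * r)))"
  proof (rule wp_unchanged[OF wp_samples[OF l(6,7) pos, where B = B]], goal_cases)
    case (1 s')
    have u: "regs s' ''lim'' = a * r" "regs s' ''r'' = r" "regs s' ''L'' = L" "env s'"
      using 1(2) l by (simp_all add: unchanged_def main_defs program_defs env_def)
    have "time s' \<le> time s + 2 + 110 * ((n div a + 1) * L) * (a * r) + 1"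
      using 1(1) unfolding l by blast
    then have "time s' + 1 \<le> time s + 230 * (n * L * r)" using T by linarith
    then show ?case
      using u 1(1) l(8)
      by (simp add: level_env_def env_def sound_def good_def output_walk_def)
  qed
  then show ?thesis
    unfolding level_def wp_Seq wp_Assign A(1) s1_def[symmetric]
    by (subst A(2)) (simp_all add: s1_def s2_def)
qed

text \<open>\<open>s\<close> runs through the powers of \<open>r\<close> until it exceeds
  \<open>n\<close>, so \<open>n < r ^ k\<close> leaves at most \<open>k - i\<close> levels. The
  constant 231 includes the loop test.\<close>

lemma wp_levels:
  assumes a: "regs s ''s'' = r ^ i" and e: "level_env r L s" and i: "i \<le> k" "n < r ^ k"
    and rL: "0 < r" "r \<le> n" "0 < L" "L \<le> n"
  shows "wp w levels s (\<lambda>s'. sound s' \<and> (good B s \<longrightarrow> good B s') \<and>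
    time s' \<le> time s + (k - i) * (231 * (n * L * r)) + 1)"
  unfolding levels_def
proof (rule wp_While[where m = "\<lambda>s. Suc n - regs s ''s''" and
    I = "\<lambda>s'. level_env r L s' \<and> (good B s \<longrightarrow> good B s') \<and>
      (\<exists>j\<ge>i. j \<le> k \<and> regs s' ''s'' = r ^ j \<and> time s' \<le> time s + (j - i) * (231 * (n * L * r)))"],
    goal_cases)
  case 1
  then show ?case using a e i by auto
next
  case (2 s')
  then obtain j where j: "i \<le> j" "j \<le> k" "regs s' ''s'' = r ^ j"
    and t: "time s' \<le> time s + (j - i) * (231 * (n * L * r))" by auto
  have le: "r ^ j \<le> n" using 2 j by (simp add: level_env_def env_def)
  have "j < k" using le i j by (cases "j = k") auto
  \<comment> \<open>\<open>n < r ^ k\<close> excludes \<open>r = 1\<close>; so \<open>s\<close>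
    grows strictly and the loop ends.\<close>
  have r2: "2 \<le> r"
    using i rL a n_ge by (cases "r = 1") auto
  have I: "level_env r L (tick s')" "good B s \<longrightarrow> good B (tick s')" "regs (tick s') ''s'' = r ^ j"
    using 2 j by (auto simp: level_env_def env_def sound_def good_def output_walk_def)
  show ?case
  proof (rule wp_mono[OF wp_level[OF I(3) _ le I(1) rL, of B]], goal_cases)
    case 1
    then show ?case using rL by simp
  next
    case (2 s'')
    have "1 \<le> n * L * r" using rL n_ge by (simp add: Suc_le_eq)
    moreover have "time s'' \<le> time s' + 1 + 230 * (n * L * r)" using 2 by simp
    ultimately have "time s'' \<le> time s' + 231 * (n * L * r)" by linarith
    also have "\<dots> \<le> time s + (j - i) * (231 * (n * L * r)) + 231 * (n * L * r)" using t by simp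
    also have "\<dots> = time s + (Suc j - i) * (231 * (n * L * r))"
      using j by (simp add: Suc_diff_le)
    finally have "time s'' \<le> time s + (Suc j - i) * (231 * (n * L * r))" .
    moreover have "r ^ j < r ^ j * r" using rL r2 by simp
    ultimately show ?case
      using 2 I(2) \<open>j < k\<close> j le
      by (auto intro!: exI[of _ "Suc j"] simp: mult.commute diff_less_mono2)
  qed
next
  case (3 s')
  then obtain j where j: "i \<le> j" "j \<le> k"
    and t: "time s' \<le> time s + (j - i) * (231 * (n * L * r))" by auto
  have "(j - i) * (231 * (n * L * r)) \<le> (k - i) * (231 * (n * L * r))"
    using j by (intro mult_right_mono) auto
  with t have "time s' \<le> time s + (k - i) * (231 * (n * L * r))" by linarith
  moreover have "sound s'" "good B s \<longrightarrow> good B s'" using 3 by (auto simp: level_env_def)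
  ultimately show ?case by (simp add: sound_def good_def output_walk_def)
qed

lemma pr_level:
  assumes a: "regs s ''s'' = a" "0 < a" and e: "level_env r L s"
    and rL: "0 < r" "r \<le> n" "0 < L" "L \<le> n" "n \<le> 2 ^ L"
    and S: "S \<subseteq> {..<n}" "card S = a" "mutually_close (parcs G) d S Z" "2 * (d + 1) \<le> B"
    and no: "\<nexists>S. S \<subseteq> {..<n} \<and> card S = a * r \<and> mutually_close (parcs G) (2 * d + 1) S Z"
  shows "1 - 1 / n \<le> pr w level s (good B)"
proof -
  have an: "a \<le> n" using S(1,2) card_mono[of "{..<n}" S] by simp
  define s1 where "s1 = tick (set_reg ''N'' ((n div a + 1) * L) s)"
  define s2 where "s2 = tick (set_reg ''lim'' (a * r) s1)"
  note A = level_arith[OF a an e rL(2,4)]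
  have l: "regs s2 ''lim'' = a * r" "regs s2 ''N'' = (n div a + 1) * L" "env s2" "sound s2"
    using e by (auto simp: s1_def s2_def level_env_def env_def sound_def output_walk_def)
  have "1 - 1 / n \<le> 1 - (1 - card S / n) ^ regs s2 ''N''"
    using miss_probability_le[OF _ an a(2) rL(5)] n_ge unfolding l S(2) by simp
  also have "\<dots> \<le> pr w samples s2 (good B)"
    by (rule pr_samples[OF S(1,3,4) no _ l(3,4,1)]) (use a rL in simp)
  finally have "1 - 1 / n \<le> pr w (Seq samples (Assign ''s'' (Reg ''lim''))) s2 (good B)"
    by (rule pr_Seq_wp) (simp add: good_def output_walk_def)
  then show ?thesis
    unfolding level_def pr_Assign_Seq A(1) s1_def[symmetric]
    by (subst A(2)) (simp_all add: s1_def s2_def)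
qed

text \<open>Induction on the number of levels before \<open>i'\<close>. Those only have to
  terminate, level \<open>i'\<close> succeeds with the required probability, and the later ones keep
  the cycle by \<open>wp_levels\<close>.\<close>

lemma pr_levels:
  assumes i: "i \<le> i'" "regs s ''s'' = r ^ i" and e: "level_env r L s" and k: "n < r ^ k"
    and rL: "0 < r" "r \<le> n" "0 < L" "L \<le> n" "n \<le> 2 ^ L"
    and S: "S \<subseteq> {..<n}" "card S = r ^ i'" "mutually_close (parcs G) d S Z" "2 * (d + 1) \<le> B"
    and no: "\<nexists>S. S \<subseteq> {..<n} \<and> card S = r ^ Suc i' \<and> mutually_close (parcs G) (2 * d + 1) S Z"
  shows "1 - 1 / n \<le> pr w levels s (good B)"
  using i e
proof (induction "i' - i" arbitrary: i s)
  have i'n: "r ^ i' \<le> n" using S(1,2) card_mono[of "{..<n}" S] by simp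
  have r1: "1 \<le> r" using rL by simp
  have i'k: "i' < k" using i'n k r1 power_increasing[of k i' r] by (cases "i' < k") auto
  case 0
  then have i: "i = i'" by simp
  have e': "level_env r L (tick s)" "regs (tick s) ''s'' = r ^ i'"
    using 0 i by (auto simp: level_env_def env_def sound_def output_walk_def)
  have pos: "0 < r ^ i'" using rL by simp
  have "1 - 1 / n \<le> pr w level (tick s) (good B)"
    by (rule pr_level[OF e'(2) pos e'(1) rL S]) (use no in \<open>simp add: mult.commute\<close>)
  also have "\<dots> = pr w level (tick s) (\<lambda>s'. good B s' \<and> (level_env r L s' \<and> regs s' ''s'' = r ^ i' * r \<and>
    (good B (tick s) \<longrightarrow> good B s') \<and> time s' \<le> time (tick s) + 230 * (n * L * r)))"
    by (rule pr_conj_wp[symmetric]) (rule wp_level[OF e'(2) pos i'n e'(1) rL(1-4)])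
  finally have "1 - 1 / n \<le> pr w (Seq level levels) (tick s) (good B)"
  proof (rule pr_Seq_wp, goal_cases)
    case (1 s')
    then have s': "regs s' ''s'' = r ^ Suc i'" "level_env r L s'" "good B s'" by simp_all
    have "Suc i' \<le> k" using i'k by simp
    from wp_levels[OF s'(1,2) this k rL(1-4), where B = B]
    show ?case by (rule wp_mono) (use s'(3) in blast)
  qed
  then show ?case
    using e' i i'n 0 unfolding levels_def
    by (subst pr_While_unfold) (simp add: level_env_def env_def)
next
  have i'n: "r ^ i' \<le> n" using S(1,2) card_mono[of "{..<n}" S] by simp
  case (Suc x)
  have e': "level_env r L (tick s)" "regs (tick s) ''s'' = r ^ i"
    using Suc by (auto simp: level_env_def env_def sound_def output_walk_def)
  have "r ^ i \<le> r ^ i'" using rL Suc by (intro power_increasing) auto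
  with i'n have le: "r ^ i \<le> n" by simp
  have pos: "0 < r ^ i" using rL by simp
  have "1 - 1 / n \<le> pr w (Seq level levels) (tick s) (good B)"
  proof (rule pr_Seq_ge[OF wp_level[OF e'(2) pos le e'(1) rL(1-4), where B = B]], goal_cases)
    case (1 s')
    then show ?case using Suc(1)[of "Suc i" s'] Suc(2) by (simp add: mult.commute)
  qed
  then show ?case
    using e' le Suc unfolding levels_def
    by (subst pr_While_unfold) (simp add: level_env_def env_def)
qed

end

section \<open>Parameters and total cost\<close>

context girth_input
begin

lemma wp_log_size:
  assumes "regs s ''n'' = n" "regs s ''L'' = 0"
  shows "wp w log_size s (\<lambda>s'. n \<le> 2 ^ regs s' ''L'' \<and> 0 < regs s' ''L'' \<and>
    2 ^ (regs s' ''L'' - 1) < n \<and> time s' \<le> time s + 3 * regs s' ''L'' + 2)"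
  unfolding log_size_def wp_Seq wp_Assign
proof (rule wp_While_unchanged[where m = "\<lambda>s. n - regs s ''q''" and
    I = "\<lambda>s'. regs s' ''q'' = 2 ^ regs s' ''L'' \<and> (0 < regs s' ''L'' \<longrightarrow> 2 ^ (regs s' ''L'' - 1) < n) \<and>
      time s' \<le> time s + 3 * regs s' ''L'' + 1"], goal_cases)
  case 1
  then show ?case using assms by simp
next
  case (2 s')
  have n: "regs s' ''n'' = n" using 2(2) assms by (auto simp: unchanged_def)
  have lt: "2 ^ regs s' ''L'' < n" using 2 n by simp
  then have "regs s' ''L'' < n" using less_exp[of "regs s' ''L''"] by linarith
  moreover have "2 ^ regs s' ''L'' + 2 ^ regs s' ''L'' \<le> n + n * n"
    using lt n_ge by (intro add_mono) (auto intro: order_trans[of _ n])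
  ultimately have "take_bit w (Suc (regs s' ''L'')) = Suc (regs s' ''L'')"
    "take_bit w ((2::nat) ^ regs s' ''L'' + 2 ^ regs s' ''L'') = 2 ^ regs s' ''L'' + 2 ^ regs s' ''L''"
    by (auto intro: take_bit_le take_bit_Suc_le_n)
  then show ?case using 2 n lt by (simp add: diff_less_mono2)
next
  case (3 s')
  have n: "regs s' ''n'' = n" using 3(2) assms by (auto simp: unchanged_def)
  then show ?case using 3 n_ge by (cases "regs s' ''L''") auto
qed

lemma wp_try_base:
  assumes "regs s ''n'' = n" "regs s ''k'' = k" "k < 2 ^ w" "regs s ''r'' < n"
  shows "wp w try_base s (\<lambda>s'. regs s' ''r'' = Suc (regs s ''r'') \<and>
    (n < regs s' ''p'' \<longleftrightarrow> n < Suc (regs s ''r'') ^ k) \<and>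
    time s' \<le> time s + 3 * k + 4)"
proof -
  let ?r = "Suc (regs s ''r'')"
  have tr: "take_bit w ?r = ?r" using assms by (intro take_bit_Suc_le_n) simp
  have loop: "wp w (While (BAnd (Less (Reg ''c'') (Reg ''k'')) (BNot (Less (Reg ''n'') (Reg ''p''))))
      (Seq (Assign ''p'' (Mul (Reg ''p'') (Reg ''r'')))
        (Assign ''c'' (Add (Reg ''c'') (Const 1))))) s0
      (\<lambda>s'. regs s' ''r'' = ?r \<and> (n < regs s' ''p'' \<longleftrightarrow> n < ?r ^ k) \<and> time s' \<le> time s + 3 * k + 4)"
    if s0: "regs s0 ''n'' = n" "regs s0 ''k'' = k" "regs s0 ''r'' = ?r" "regs s0 ''p'' = 1"
      "regs s0 ''c'' = 0" "time s0 = time s + 3" for s0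
  proof (rule wp_While_unchanged[where m = "\<lambda>s. k - regs s ''c''" and
        I = "\<lambda>s'. regs s' ''p'' = ?r ^ regs s' ''c'' \<and> regs s' ''c'' \<le> k \<and>
          time s' \<le> time s + 3 * regs s' ''c'' + 3"], goal_cases)
    case 1
    then show ?case using s0 by simp
  next
    case (2 s')
    have u: "regs s' ''n'' = n" "regs s' ''k'' = k" "regs s' ''r'' = ?r"
      using 2(2) s0 by (auto simp: unchanged_def)
    have c: "regs s' ''c'' < k" "?r ^ regs s' ''c'' \<le> n" using 2 u by auto
    have "?r ^ regs s' ''c'' * ?r \<le> n * n"
      using c assms by (intro mult_mono) auto
    then have "take_bit w (?r ^ regs s' ''c'' * ?r) = ?r ^ regs s' ''c'' * ?r"
      by (intro take_bit_le) simp
    moreover have "take_bit w (Suc (regs s' ''c'')) = Suc (regs s' ''c'')"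
      using c assms by (intro take_bit_nat_eq_self) simp
    ultimately show ?case using 2 u c by (auto simp: mult.commute)
  next
    case (3 s')
    have u: "regs s' ''n'' = n" "regs s' ''k'' = k" "regs s' ''r'' = ?r"
      using 3(2) s0 by (auto simp: unchanged_def)
    \<comment> \<open>If the multiplication stopped early, the partial power already exceeds
      \<open>n\<close>, and so does the full one.\<close>
    have "?r ^ regs s' ''c'' \<le> ?r ^ k" using 3 by (intro power_increasing) auto
    moreover have "regs s' ''c'' = k \<or> n < ?r ^ regs s' ''c''" using 3 u by auto
    ultimately have "n < regs s' ''p'' \<longleftrightarrow> n < ?r ^ k" using 3 by auto
    then show ?case using 3 u by auto
  qed
  show ?thesis
    unfolding try_base_def wp_Seq wp_Assign
    by (rule loop) (use assms tr in simp_all)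
qed

lemma wp_root_base:
  assumes "regs s ''n'' = n" "regs s ''k'' = k" "k < 2 ^ w" "2 \<le> k" "regs s ''p'' = 0"
  shows "wp w root_base s (\<lambda>s'. n < regs s' ''r'' ^ k \<and> 0 < regs s' ''r'' \<and>
    (regs s' ''r'' - 1) ^ k \<le> n \<and> regs s' ''r'' \<le> n \<and>
    time s' \<le> time s + regs s' ''r'' * (6 * k) + 2)"
  unfolding root_base_def wp_Seq wp_Assign
proof (rule wp_While_unchanged[where m = "\<lambda>s. n - regs s ''r''" and
    I = "\<lambda>s'. 0 < regs s' ''r'' \<and> regs s' ''r'' \<le> n \<and>
      (if n < regs s' ''p'' then n < regs s' ''r'' ^ k \<and> (regs s' ''r'' - 1) ^ k \<le> n
       else regs s' ''r'' ^ k \<le> n) \<and>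
      time s' \<le> time s + regs s' ''r'' * (6 * k) + 1"], goal_cases)
  case 1
  then show ?case using assms n_ge by simp
next
  case (2 s')
  let ?r = "regs s' ''r''"
  have u: "regs s' ''n'' = n" "regs s' ''k'' = k"
    using 2(2) assms by (auto simp: unchanged_def main_defs)
  have r: "0 < ?r" "?r ^ k \<le> n" and t: "time s' \<le> time s + ?r * (6 * k) + 1" using 2 u by auto
  \<comment> \<open>As \<open>k \<ge> 2\<close>, a failed candidate is at most the square root of
    \<open>n\<close>, so the next candidate is still at most \<open>n\<close>.\<close>
  have "?r ^ 2 \<le> ?r ^ k" using r assms by (intro power_increasing) auto
  with r have sq: "?r * ?r \<le> n" by (simp add: power2_eq_square)
  have "?r < n"
  proof (cases "?r = 1")
    case False
    then have "2 * ?r \<le> ?r * ?r" using r by (intro mult_right_mono) auto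
    then show ?thesis using sq r by linarith
  qed (use n_ge in simp)
  then have "wp w try_base (tick s') (\<lambda>s''. regs s'' ''r'' = Suc (regs (tick s') ''r'') \<and>
    (n < regs s'' ''p'' \<longleftrightarrow> n < Suc (regs (tick s') ''r'') ^ k) \<and>
    time s'' \<le> time (tick s') + 3 * k + 4)"
    using u assms by (intro wp_try_base) auto
  \<comment> \<open>One candidate costs \<open>3 * k + 5\<close>, loop test included, which is at
    most \<open>6 * k\<close> for \<open>k \<ge> 2\<close>.\<close>
  then show ?case
    by (rule wp_mono) (use \<open>?r < n\<close> r t assms in \<open>auto simp: diff_less_mono2 not_less\<close>)
next
  case (3 s')
  have u: "regs s' ''n'' = n"
    using 3(2) assms by (auto simp: unchanged_def main_defs)
  then show ?case using 3 by auto
qed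

lemma wp_setup_regs:
  assumes s: "env s" "regs s ''k'' = k" "regs s ''p'' = 0" "regs s ''L'' = 0" "time s = 0"
    and k: "k < 2 ^ w" "2 \<le> k"
  shows "wp w setup_regs s (\<lambda>s'. \<exists>r L. level_env r L s' \<and> regs s' ''s'' = 1 \<and>
    0 < r \<and> r \<le> n \<and> n < r ^ k \<and> (r - 1) ^ k \<le> n \<and>
    0 < L \<and> L \<le> n \<and> n \<le> 2 ^ L \<and> 2 ^ (L - 1) < n \<and>
    time s' \<le> 15 * (k * n * L * r))"
  unfolding setup_regs_def wp_Seq
proof (rule wp_unchanged[OF wp_log_size], goal_cases)
  case (3 s1)
  define L where "L = regs s1 ''L''"
  have s1: "env s1" "regs s1 ''k'' = k" "regs s1 ''p'' = 0"
    using 3(2) s by (auto simp: unchanged_def main_defs env_def)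
  have L: "n \<le> 2 ^ L" "0 < L" "2 ^ (L - 1) < n" "time s1 \<le> 3 * L + 2"
    using 3(1) s by (auto simp: L_def)
  have Ln: "L \<le> n" using L(2,3) less_exp[of "L - 1"] by linarith
  show ?case
  proof (rule wp_unchanged[OF wp_root_base[where k = k]], goal_cases)
    case (6 s2)
    define r where "r = regs s2 ''r''"
    have s2: "env s2" "regs s2 ''L'' = L"
      using 6(2) s1 by (auto simp: unchanged_def main_defs env_def L_def)
    have r: "n < r ^ k" "0 < r" "(r - 1) ^ k \<le> n" "r \<le> n" "time s2 \<le> 3 * L + 2 + r * (6 * k) + 2"
      using 6(1) L by (auto simp: r_def)
    have tb: "take_bit w (Suc n) = Suc n" by (rule take_bit_Suc_le_n) simp
    have "L \<le> k * n * L * r" "r * k \<le> k * n * L * r" "1 \<le> k * n * L * r"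
      using k n_ge L(2) r(2) by (auto simp: Suc_le_eq)
    moreover have "time s2 + 2 \<le> 3 * L + 6 * (r * k) + 6" using r(5) by simp
    ultimately have "time s2 + 2 \<le> 15 * (k * n * L * r)" by linarith
    then show ?case
      using s2 r L Ln tb
      by (auto simp: level_env_def env_def sound_def r_def intro!: exI[of _ r] exI[of _ L])
  qed (use s1 k in \<open>auto simp: env_def\<close>)
qed (use s in \<open>auto simp: env_def\<close>)

text \<open>The setup fixes \<open>r\<close> before any vertex is drawn, so the scale
  \<open>i\<close> chosen below does not depend on the draws and one application of
  \<open>pr_levels\<close> suffices.\<close>

lemma girth_program_correct:
  assumes s: "env s" "regs s ''k'' = k" "regs s ''p'' = 0" "regs s ''L'' = 0" "time s = 0"
    and k: "k < 2 ^ w" "2 \<le> k"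
    and g: "mutually_close (parcs G) (g - 1) Z Z" "0 < g"
  shows "1 - 1 / n \<le> pr w girth_program s (good (2 ^ k * g))"
  unfolding girth_program_def
proof (rule pr_Seq_ge[OF wp_setup_regs[OF s k]], elim exE conjE, goal_cases)
  case (1 s' r L)
  define P where "P i \<longleftrightarrow> (\<exists>S. S \<subseteq> {..<n} \<and> card S = r ^ i \<and>
    mutually_close (parcs G) (2 ^ i * g - 1) S Z)" for i
  obtain z where z: "z \<in> Z" using Z by auto
  \<comment> \<open>A single vertex of \<open>Z\<close> is the witness: \<open>r ^ 0 = 1\<close> and
    the radius is \<open>g - 1\<close>.\<close>
  have "P 0" unfolding P_def
    using z Z(1) g by (intro exI[of _ "{z}"]) (auto simp: mutually_close_def)
  have bound: "i < k" if "P i" for i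
  proof (rule ccontr)
    assume "\<not> i < k"
    then have "r ^ k \<le> r ^ i" using 1 by (intro power_increasing) auto
    moreover from that obtain S where "S \<subseteq> {..<n}" "card S = r ^ i" by (auto simp: P_def)
    then have "r ^ i \<le> n" using card_mono[of "{..<n}" S] by simp
    ultimately show False using 1 by linarith
  qed
  have "\<exists>i. P i \<and> \<not> P (Suc i)"
  proof (rule ccontr)
    assume "\<not> ?thesis"
    then have "P i" for i using \<open>P 0\<close> by (induction i) auto
    then show False using bound by blast
  qed
  then obtain i where i: "P i" "\<not> P (Suc i)" by blast
  define d where "d = 2 ^ i * g - 1"
  \<comment> \<open>With truncated subtraction, \<open>2 * d + 1\<close> is the radius of scale
    \<open>Suc i\<close> only because \<open>2 ^ i * g \<ge> 1\<close>.\<close>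
  have d: "2 * d + 1 = 2 ^ Suc i * g - 1" "2 * (d + 1) = 2 ^ Suc i * g"
  proof -
    define x where "x = 2 ^ i * g"
    have "1 \<le> x" using g(2) by (simp add: x_def Suc_le_eq)
    moreover have "2 ^ Suc i * g = 2 * x" by (simp add: x_def)
    ultimately show "2 * d + 1 = 2 ^ Suc i * g - 1" "2 * (d + 1) = 2 ^ Suc i * g"
      unfolding d_def x_def[symmetric] by simp_all
  qed
  have "(2::nat) ^ Suc i \<le> 2 ^ k" using bound[OF i(1)] by (intro power_increasing) auto
  then have B: "2 * (d + 1) \<le> 2 ^ k * g" unfolding d by (rule mult_right_mono) simp
  from i(1) obtain S where S: "S \<subseteq> {..<n}" "card S = r ^ i" "mutually_close (parcs G) d S Z"
    by (auto simp: P_def d_def)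
  have no: "\<nexists>S. S \<subseteq> {..<n} \<and> card S = r ^ Suc i \<and> mutually_close (parcs G) (2 * d + 1) S Z"
    using i(2) unfolding P_def d by blast
  show ?case
    by (rule pr_levels[where i = 0 and r = r and L = L and k = k, OF _ _ _ _ _ _ _ _ _ S B no])
      (use 1 in simp_all)
qed

lemma girth_program_time:
  assumes s: "env s" "regs s ''k'' = k" "regs s ''p'' = 0" "regs s ''L'' = 0" "time s = 0"
    and k: "k < 2 ^ w" "2 \<le> k"
  shows "wp w girth_program s (\<lambda>s'.
    real (time s') \<le> 1600 * real n powr (1 + 1 / real k) * real k * ln (real n))"
  unfolding girth_program_def wp_Seq
proof (rule wp_mono[OF wp_setup_regs[OF s k]], elim exE conjE, goal_cases)
  case (1 s' r L)
  show ?case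
  proof (rule wp_mono[OF wp_levels[where s = s' and i = 0 and r = r and L = L and k = k and B = 0]], goal_cases)
    case (9 s'')
    let ?x = "k * n * L * r"
    have "1 \<le> ?x" using k n_ge 1 by (simp add: Suc_le_eq)
    moreover have "time s'' \<le> 15 * ?x + 231 * ?x + 1"
      using 9 1 by (simp add: algebra_simps)
    \<comment> \<open>Setup 15, levels 231 and the last test 1 add up to 247, rounded up.\<close>
    ultimately have "time s'' \<le> 250 * ?x" by linarith
    then have T: "real (time s'') \<le> 250 * (real k * real n * real L * real r)"
      by (metis (mono_tags) of_nat_le_iff of_nat_mult of_nat_numeral)
    have n3: "3 \<le> real n" using n_ge by simp
    have ln1: "1 \<le> ln (real n)"
      using n3 exp_le by (subst ln_ge_iff) auto
    \<comment> \<open>Minimality of \<open>L\<close> and \<open>ln 2 \<ge> 1 / 2\<close> bound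
      \<open>L - 1\<close> by \<open>2 * ln n\<close>; the remaining 1 is at most
      \<open>ln n\<close> because \<open>n \<ge> 3\<close>.\<close>
    have L: "real L \<le> 3 * ln (real n)"
    proof -
      have "real (2 ^ (L - 1)) < real n" using 1 by (simp only: of_nat_less_iff)
      then have "ln (2 ^ (L - 1)) < ln (real n)" by simp
      then have "real (L - 1) * ln 2 < ln (real n)" by (simp add: ln_realpow)
      moreover have "real (L - 1) * (1 / 2) \<le> real (L - 1) * ln 2"
        using ln2_ge_two_thirds by (intro mult_left_mono) auto
      moreover have "real L = real (L - 1) + 1" using 1 by simp
      ultimately show ?thesis using ln1 by linarith
    qed
    \<comment> \<open>Minimality of \<open>r\<close> bounds \<open>r - 1\<close> by the
      \<open>k\<close>-th root of \<open>n\<close>, and the remaining 1 is at most that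
      root.\<close>
    have r: "real r \<le> 2 * real n powr (1 / real k)"
    proof -
      have "real (r - 1) \<le> real n powr (1 / real k)"
      proof (cases "r - 1 = 0")
        case False
        have "real (r - 1) = (real (r - 1) powr real k) powr (1 / real k)"
          using False k by (simp add: powr_powr)
        also have "real (r - 1) powr real k = real ((r - 1) ^ k)"
          using False by (simp add: powr_realpow)
        also have "real ((r - 1) ^ k) powr (1 / real k) \<le> real n powr (1 / real k)"
          using 1 by (intro powr_mono2) (auto simp del: of_nat_power)
        finally show ?thesis .
      qed simp
      moreover have "1 \<le> real n powr (1 / real k)" using n3 by (intro ge_one_powr_ge_zero) auto
      moreover have "real r = real (r - 1) + 1" using 1 by simp
      ultimately show ?thesis by linarith
    qed
    have "250 * (real k * real n * real L * real r) \<le>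
      250 * (real k * real n * (3 * ln (real n)) * (2 * real n powr (1 / real k)))"
      using L r ln1 by (intro mult_mono mult_nonneg_nonneg) auto
    also have "\<dots> = 1500 * (real n * real n powr (1 / real k)) * real k * ln (real n)" by simp
    also have "real n * real n powr (1 / real k) = real n powr (1 + 1 / real k)"
      using n3 by (simp add: powr_add)
    also have "1500 * real n powr (1 + 1 / real k) * real k * ln (real n) \<le>
      1600 * real n powr (1 + 1 / real k) * real k * ln (real n)"
      using ln1 by (intro mult_right_mono) auto
    finally show ?case using T by linarith
  qed (use 1 in simp_all)
qed

end

section \<open>From adjacency lists to the array representation\<close>

lemma length_concat_take_Suc:
  "v < length A \<Longrightarrow>
    length (concat (take (Suc v) A)) = length (concat (take v A)) + length (A ! v)"
  by (simp add: take_Suc_conv_app_nth)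

lemma concat_nth_block:
  assumes "v < length A" "i < length (A ! v)"
  shows "concat A ! (length (concat (take v A)) + i) = A ! v ! i"
    and "length (concat (take v A)) + i < length (concat A)"
proof -
  have "concat A = concat (take v A) @ A ! v @ concat (drop (Suc v) A)"
    using id_take_nth_drop[OF assms(1)] by (metis concat.simps(2) concat_append)
  then show "concat A ! (length (concat (take v A)) + i) = A ! v ! i"
    and "length (concat (take v A)) + i < length (concat A)"
    using assms by (simp_all add: nth_append)
qed

lemma length_concat_take_le:
  assumes "\<And>v. v < length A \<Longrightarrow> length (A ! v) \<le> b" "v \<le> length A"
  shows "length (concat (take v A)) \<le> v * b"
  using assms(2)
proof (induction v)
  case (Suc v)
  then show ?case using length_concat_take_Suc[of v A] assms(1)[of v] by simp
qed simp

text \<open>Connectedness is defined through the symmetric closure, which adds nothing to a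
  symmetric arc set.\<close>

lemma connected_rtrancl:
  assumes "pair_graph G" "Digraph_Component.connected (with_proj G)" "x \<in> pverts G" "y \<in> pverts G"
  shows "(x, y) \<in> (parcs G)\<^sup>*"
proof -
  interpret pair_graph G by fact
  have "x \<rightarrow>\<^sup>*\<^bsub>mk_symmetric (with_proj G)\<^esub> y"
    using assms(2-4) by (auto simp: Digraph_Component.connected_def strongly_connected_def)
  then have "x \<rightarrow>\<^sup>*\<^bsub>with_proj G\<^esub> y"
    by (simp only: reachable_mk_symmetric_eq[OF pair_sym_arcs])
  then have "(x, y) \<in> rtrancl_on (pverts G) (parcs G)"
    by (simp add: reachable_def)
  then show ?thesis
    by (induction rule: rtrancl_on.induct) (auto intro: rtrancl_into_rtrancl converse_rtrancl_into_rtrancl)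
qed

lemma girth_input_input_state:
  assumes "pair_graph G" "Digraph_Component.connected (with_proj G)" "adjacency_lists G A"
    and "length A ^ 4 \<le> 2 ^ w" "Z \<subseteq> pverts G" "Z \<noteq> {}" "two_neighbours (parcs G) Z"
  shows "girth_input G (length A)
    (array_of (map (\<lambda>v. length (concat (take v A))) [0..<Suc (length A)]))
    (array_of (concat A)) w Z"
proof -
  interpret pair_graph G by fact
  let ?n = "length A"
  let ?off = "\<lambda>v. length (concat (take v A))"
  let ?offa = "array_of (map ?off [0..<Suc ?n])"
  have V: "pverts G = {..<?n}"
    and A: "\<And>v. v < ?n \<Longrightarrow> distinct (A ! v)" "\<And>v. v < ?n \<Longrightarrow> set (A ! v) = {u. (v, u) \<in> parcs G}"
    using assms(3) by (auto simp: adjacency_lists_def)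
  have off: "?offa v = ?off v" if "v \<le> ?n" for v
    using that by (simp add: array_of_def del: upt_Suc)
  have deg: "length (A ! v) \<le> ?n" if "v < ?n" for v
  proof -
    have "set (A ! v) \<subseteq> {..<?n}" using A(2)[OF that] in_arcsD2 V by auto
    then show ?thesis
      using A(1)[OF that] card_mono[of "{..<?n}" "set (A ! v)"] by (simp add: distinct_card)
  qed
  show ?thesis
  proof unfold_locales
    show "(x, y) \<in> parcs G \<Longrightarrow> (y, x) \<in> parcs G" for x y
      using pair_sym_arcs by (auto simp: symmetric_def sym_def)
    show "(x, x) \<notin> parcs G" for x using pair_no_loops[of "(x, x)"] by auto
    show "(x, y) \<in> parcs G \<Longrightarrow> x < ?n" for x y using in_arcsD1 V by auto
    show "x < ?n \<Longrightarrow> y < ?n \<Longrightarrow> (x, y) \<in> (parcs G)\<^sup>*" for x y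
      using connected_rtrancl[OF assms(1,2)] V by auto
    show "?offa v \<le> ?offa (Suc v)" if "v < ?n" for v
      using that off[of v] off[of "Suc v"] length_concat_take_Suc[OF that] by simp
    show "bij_betw (array_of (concat A)) {?offa v..<?offa (Suc v)} {u. (v, u) \<in> parcs G}"
      if v: "v < ?n" for v
    proof -
      have adj: "array_of (concat A) (?off v + i) = A ! v ! i" if "i < length (A ! v)" for i
        using concat_nth_block[OF v that] by (simp add: array_of_def)
      have "bij_betw (\<lambda>i. A ! v ! i) {..<length (A ! v)} {u. (v, u) \<in> parcs G}"
        using bij_betw_nth[OF A(1)[OF v] refl refl] A(2)[OF v] by simp
      moreover have "bij_betw (\<lambda>p. p - ?off v) {?off v..<?off (Suc v)} {..<length (A ! v)}"
        by (rule bij_betw_byWitness[where f' = "\<lambda>i. ?off v + i"])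
          (auto simp: length_concat_take_Suc[OF v])
      ultimately have "bij_betw ((\<lambda>i. A ! v ! i) \<circ> (\<lambda>p. p - ?off v))
          {?off v..<?off (Suc v)} {u. (v, u) \<in> parcs G}"
        by (rule bij_betw_trans[rotated])
      then have "bij_betw (array_of (concat A)) {?off v..<?off (Suc v)} {u. (v, u) \<in> parcs G}"
      proof (rule bij_betw_cong[THEN iffD1, rotated])
        fix p assume p: "p \<in> {?off v..<?off (Suc v)}"
        then have "p - ?off v < length (A ! v)" using length_concat_take_Suc[OF v] by auto
        then show "((\<lambda>i. A ! v ! i) \<circ> (\<lambda>p. p - ?off v)) p = array_of (concat A) p"
          using adj[of "p - ?off v"] p by simp
      qed
      then show ?thesis using v off[of v] off[of "Suc v"] by simp
    qed
    show "pverts G = {..<?n}" "?n ^ 4 \<le> 2 ^ w" by fact+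
    show "?offa v \<le> ?n * ?n" if "v \<le> ?n" for v
    proof -
      have "?offa v \<le> v * ?n"
        unfolding off[OF that] by (rule length_concat_take_le[OF deg that])
      also have "\<dots> \<le> ?n * ?n" using that by simp
      finally show ?thesis .
    qed
    show "Z \<subseteq> {..<?n}" "Z \<noteq> {}" "two_neighbours (parcs G) Z" using assms V by auto
    \<comment> \<open>A vertex of \<open>Z\<close> and its two neighbours in \<open>Z\<close> are
      three different vertices, as there are no loops.\<close>
    obtain z where "z \<in> Z" using assms(6) by blast
    then obtain x y where xy: "x \<in> Z" "y \<in> Z" "x \<noteq> y" "(z, x) \<in> parcs G" "(z, y) \<in> parcs G"
      using assms(7) unfolding two_neighbours_def by blast
    then have "z \<noteq> x" "z \<noteq> y" using pair_no_loops by force+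
    then have "card {x, y, z} = 3" using xy(3) by simp
    moreover have "{x, y, z} \<subseteq> {..<?n}" using xy \<open>z \<in> Z\<close> assms(5) V by auto
    ultimately show "3 \<le> ?n" using card_mono[of "{..<?n}" "{x, y, z}"] by simp
  qed
qed

theorem theorem3:
  shows "\<exists>(P :: com) (c :: nat) (C :: real).
    \<forall>(G :: nat pair_pre_digraph) (A :: nat list list) (n :: nat) (k :: nat) (w :: nat).
      pair_graph G \<and> Digraph_Component.connected (with_proj G) \<and> (\<exists>p. ucycle G p) \<and>
      n = card (pverts G) \<and> adjacency_lists G A \<and> 2 \<le> k \<and> n ^ c \<le> 2 ^ w \<and> k < 2 ^ w \<longrightarrow>
      measure (measure_spmf (exec w P (input_state A k)))
        {s. ucycle G (output_walk s) \<and>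
            girth G \<le> length (output_walk s) \<and>
            length (output_walk s) \<le> 2 ^ k * girth G} \<ge> 1 - 1 / real n \<and>
      expected_time (exec w P (input_state A k))
        \<le> ennreal (C * real n powr (1 + 1 / real k) * real k * ln (real n))"
\<comment> \<open>The exponent 4 is that of the locale assumption \<open>word\<close>; 1600 comes
  from \<open>girth_program_time\<close>.\<close>
proof (rule exI[of _ girth_program], rule exI[of _ 4], rule exI[of _ 1600],
    intro allI impI, elim conjE exE)
  fix G :: "nat pair_pre_digraph" and A :: "nat list list" and n k w :: nat and p
  assume G: "pair_graph G" "Digraph_Component.connected (with_proj G)" and p: "ucycle G p"
    and n: "n = card (pverts G)" and A: "adjacency_lists G A"
    and k: "2 \<le> k" "n ^ 4 \<le> 2 ^ w" "k < 2 ^ w"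
  obtain q where q: "ucycle G q" "length q = girth G" using girth_attained[OF p] .
  obtain Z where cyc: "Z \<noteq> {}" "Z \<subseteq> pverts G" "two_neighbours (parcs G) Z"
    "mutually_close (parcs G) (girth G - 1) Z Z"
    using ucycle_vertex_set[OF G(1) q(1)] q(2) by metis
  have nA: "n = length A" using n A by (simp add: adjacency_lists_def)
  interpret girth_input G n "array_of (map (\<lambda>v. length (concat (take v A))) [0..<Suc (length A)])"
    "array_of (concat A)" w Z
    unfolding nA using k(2) nA cyc by (intro girth_input_input_state G A) auto
  let ?s = "input_state A k"
  have s: "env ?s" "regs ?s ''k'' = k" "regs ?s ''p'' = 0" "regs ?s ''L'' = 0" "time ?s = 0"
    unfolding env_def by (simp_all add: input_state_def nA del: upt_Suc)
  have g: "0 < girth G" using q by (auto simp: ucycle_def)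
  \<comment> \<open>The lower bound by the girth holds for every cycle, so the event reduces to
    \<open>good\<close>.\<close>
  have "{s. ucycle G (output_walk s) \<and> girth G \<le> length (output_walk s) \<and>
      length (output_walk s) \<le> 2 ^ k * girth G} = {s. good (2 ^ k * girth G) s}"
    by (auto simp: good_def length_output_walk girth_le[unfolded length_output_walk]
        dest: girth_le)
  then show "measure (measure_spmf (exec w girth_program ?s))
        {s. ucycle G (output_walk s) \<and> girth G \<le> length (output_walk s) \<and>
            length (output_walk s) \<le> 2 ^ k * girth G} \<ge> 1 - 1 / real n \<and>
      expected_time (exec w girth_program ?s)
        \<le> ennreal (1600 * real n powr (1 + 1 / real k) * real k * ln (real n))"
    using girth_program_correct[OF s k(3,1) cyc(4) g] expected_time_le[OF girth_program_time[OF s k(3,1)]]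
    by (simp add: pr_def)
qed

end
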